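(* Consider the same-history impulse comparison described in the context, in the inert regime (I) and the stabilized regime (S), with nonzero velocity impulse $\boldsymbol\delta$, $\delta=\|\boldsymbol\delta\|>0$, and displacement coordinate $e$ taken along $\boldsymbol\delta$. Then: **(i) Level response.** In the constant-transition model, for every $h\ge0$, $$\mu_h^I=\delta\,h\,\Delta t,\qquad \mu_h^S=\eta\,\delta\,h\,\Delta t .$$ (Under gravity these serve as local leading-order formulas, for small relative displacement and $h\Delta t\ll\sqrt{r^3/\mu}$, with $r$ the orbital radius and $\mu$ the gravitational parameter; they are not infinite-horizon Keplerian claims.) If the incident input size is unknown, the retained slope alone does not separate (I) and (S): the (S) level response to an impulse of size $\delta$ is an (I) level response to an impulse of size $\eta\delta$. **(ii) Variance response.** For the reaction-gain episode, $$v_h^I=0,\qquad v_h^S=\bigl[(1-K(h))^2-1\bigr]\operatorname{tr}\Sigma=-K(h)\,(2-K(h))\operatorname{tr}\Sigma .$$ The latter is zero when $K(h)=0$, strictly negative when $K(h)>0$, and nonincreasing in $h$ along the nondecreasing gain path. If the idealized gain path ($K(h)\to K_{\max}$) and covariance law are continued indefinitely, its limit as $h\to\infty$ is $-K_{\max}(2-K_{\max})\operatorname{tr}\Sigma<0$. If instead the same constant gain is used in both continuations, $v_h^S=0$.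
   Context: **Dynamics.** Displacement $\mathbf e_t\in\mathbb R^3$ and residual velocity $\dot{\mathbf e}_t\in\mathbb R^3$ evolve with sampling step $\Delta t>0$ by the constant-transition (double-integrator) model $$\begin{pmatrix}\mathbf e_{t+1}\\ \dot{\mathbf e}_{t+1}\end{pmatrix}=\begin{pmatrix}I_3&\Delta t\,I_3\\0&I_3\end{pmatrix}\begin{pmatrix}\mathbf e_t\\ \dot{\mathbf e}_t\end{pmatrix}+\begin{pmatrix}\mathbf 0\\ \mathbf b_{t+1}+\boldsymbol\varepsilon_{t+1}\end{pmatrix},$$ where $\mathbf b_t$ is predictable ($\mathcal F_{t-1}$-measurable, $\mathcal F_t$ being the information through step $t$) and $\boldsymbol\varepsilon_t$ is the velocity innovation with $\mathbb E[\boldsymbol\varepsilon_t\mid\mathcal F_{t-1}]=0$ and conditional covariance $H_t=\operatorname{Var}(\boldsymbol\varepsilon_t\mid\mathcal F_{t-1})$. **Comparison.** Fix the pre-impulse history $\mathcal H_0$. One continuation (superscript $\boldsymbol\delta$) receives an exogenous velocity impulse $\boldsymbol\delta$ at $t_0$, the other (superscript $0$) does not. For $h\ge0$, $$\mu_h=\mathbb E[e^{\boldsymbol\delta}_{t_0+h}\mid\mathcal H_0]-\mathbb E[e^{0}_{t_0+h}\mid\mathcal H_0],\qquad v_h=\mathbb E[\operatorname{tr}H^{\boldsymbol\delta}_{t_0+h}\mid\mathcal H_0]-\mathbb E[\operatorname{tr}H^{0}_{t_0+h}\mid\mathcal H_0],$$ with superscripts $I,S$ for the regime. The state at $t_0$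 is finite and fixed by $\mathcal H_0$, apart from the onset-retained impulse, which adds to the velocity at $t_0$ of the perturbed continuation $\boldsymbol\delta$ in (I) and $\eta\boldsymbol\delta$ in (S), for a fixed $\eta\in(0,1]$. At every future step $j$ of the response horizon both continuations satisfy $\mathbb E[\|\mathbf b_j\|+\|\boldsymbol\varepsilon_j\|\mid\mathcal H_0]<\infty$ and $\mathbb E[\mathbf b_j^{\boldsymbol\delta}\mid\mathcal H_0]=\mathbb E[\mathbf b_j^{0}\mid\mathcal H_0]$; future innovations are conditionally centered under their respective laws, with possibly different covariances. The environment is held quiet. **(I).** $H_t=g(W_t)=C+G(W_t)$, with $C\succ0$, $G(W_t)\succeq0$ and $W_t$ a predictable environment index (no feedback from realized shocks to the covariance). The conditional law of the environment given $\mathcal H_0$ is identical in both continuations and $\mathbb E[\operatorname{tr}g(W_{t_0+h})\mid\mathcal H_0]<\infty$ for all $h\ge0$. **(S).** $\boldsymbol\varepsilon_t=(1-K_t)\mathbf r_t$ with $\mathbf r_t=(1-\lambda)\boldsymbol\zeta_t+\lambda\boldsymbol\nu_t$, $\lambda\in[0,1]$ constant, where $\boldsymbol\zeta_t,\boldsymbol\nu_t$ are centered and independent given $\mathcal F_{t-1}$ with finite covariance; hence $H_t=(1-K_t)^2\operatorname{Var}(\mathbf r_t\mid\mathcal F_{t-1})$. The covariance $\operatorname{Var}(\mathbf r_t\mid\mathcal F_{t-1})$ is the same fixed $\Sigma\succ0$ in both continuations. Reaction-gain episode: in the perturbed continuation $K_{t_0+h}=K(h)$ is a nonrandom schedule (given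 $\mathcal H_0$ and the test input) with $K(0)=0$, nondecreasing, bounded by $K_{\max}\in(0,1)$, whose idealized continuation tends to $K_{\max}$; the unperturbed continuation has gain $0$. No impulse-induced mean steering acts during the response horizon. *)

theory Defs
  imports "HOL-Probability.Probability"
begin

definition pos_def :: "real^'n^'n \<Rightarrow> bool" where
  "pos_def A \<longleftrightarrow> transpose A = A \<and> (\<forall>x. x \<noteq> 0 \<longrightarrow> 0 < x \<bullet> (A *v x))"

definition pos_semidef :: "real^'n^'n \<Rightarrow> bool" where
  "pos_semidef A \<longleftrightarrow> transpose A = A \<and> (\<forall>x. 0 \<le> x \<bullet> (A *v x))"

text \<open>
  The library operator \<^const>\<open>real_cond_exp\<close> is the difference of the conditional expectations of
  the positive and negative parts, so it is meaningful whenever the conditional expectation of the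
  absolute value is finite almost surely; unconditional integrability is not needed and is not
  assumed anywhere below.  A vector-valued conditional expectation is taken componentwise.
\<close>

definition vec_cond_exp :: "'a measure \<Rightarrow> 'a measure \<Rightarrow> ('a \<Rightarrow> real^'n) \<Rightarrow> 'a \<Rightarrow> real^'n" where
  "vec_cond_exp M F X \<omega> = (\<chi> i. real_cond_exp M F (\<lambda>\<omega>. X \<omega> $ i) \<omega>)"

definition cond_cov :: "'a measure \<Rightarrow> 'a measure \<Rightarrow> ('a \<Rightarrow> real^'n) \<Rightarrow> 'a \<Rightarrow> real^'n^'n" where
  "cond_cov M F X \<omega> = (\<chi> i k. real_cond_exp M F
     (\<lambda>\<omega>. (X \<omega> $ i - vec_cond_exp M F X \<omega> $ i) * (X \<omega> $ k - vec_cond_exp M F X \<omega> $ k)) \<omega>)"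

definition cond_indep ::
    "'a measure \<Rightarrow> 'a measure \<Rightarrow> ('a \<Rightarrow> real^'n) \<Rightarrow> ('a \<Rightarrow> real^'n) \<Rightarrow> bool" where
  "cond_indep M F X Y \<longleftrightarrow> (\<forall>A\<in>sets borel. \<forall>B\<in>sets borel. AE \<omega> in M.
     real_cond_exp M F (\<lambda>\<omega>. indicator A (X \<omega>) * indicator B (Y \<omega>)) \<omega>
     = real_cond_exp M F (\<lambda>\<omega>. indicator A (X \<omega>)) \<omega> * real_cond_exp M F (\<lambda>\<omega>. indicator B (Y \<omega>)) \<omega>)"

definition cond_centered :: "'a measure \<Rightarrow> 'a measure \<Rightarrow> ('a \<Rightarrow> real^'n) \<Rightarrow> bool" where
  "cond_centered M F X \<longleftrightarrow> X \<in> borel_measurable M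
     \<and> (AE \<omega> in M. nn_cond_exp M F (\<lambda>\<omega>. ennreal ((norm (X \<omega>))\<^sup>2)) \<omega> < \<infinity>)
     \<and> (AE \<omega> in M. vec_cond_exp M F X \<omega> = 0)"

text \<open>
  A continuation carries its own law and its own information filtration.  The pre-impulse history
  is a probability space \<^term>\<open>Hist\<close>: its sigma-algebra is part of the information at \<open>t0\<close>, and the law
  of each continuation extends the measure of \<^term>\<open>Hist\<close>.  Conditional expectations given the history
  under two different laws can thus be subtracted, and almost everywhere statements about the
  difference refer to \<^term>\<open>Hist\<close>.  If the sigma-algebra of \<^term>\<open>Hist\<close> is trivial, the laws are the
  conditional laws at one fixed history.
\<close>

record 'a continuation =
  law :: "'a measure"
  info :: "nat \<Rightarrow> 'a measure"
  disp :: "nat \<Rightarrow> 'a \<Rightarrow> real^3"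
  vel :: "nat \<Rightarrow> 'a \<Rightarrow> real^3"
  steer :: "nat \<Rightarrow> 'a \<Rightarrow> real^3"
  innov :: "nat \<Rightarrow> 'a \<Rightarrow> real^3"

definition innov_cov :: "'a continuation \<Rightarrow> nat \<Rightarrow> 'a \<Rightarrow> real^3^3" where
  "innov_cov X t = cond_cov (law X) (info X (t - 1)) (innov X t)"

text \<open>
  Only the evolution from \<open>t0\<close> on matters; the past is summarized by the state at \<open>t0\<close>,
  and future steps are those with \<open>j > t0\<close>.
\<close>

definition continuation_model :: "real \<Rightarrow> nat \<Rightarrow> 'a measure \<Rightarrow> 'a continuation \<Rightarrow> bool" where
  "continuation_model dt t0 Hist X \<longleftrightarrow>
     prob_space (law X) \<and> filtration (space (law X)) (info X)
     \<and> (\<forall>t. subalgebra (law X) (info X t))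
     \<and> subalgebra (info X t0) Hist \<and> restr_to_subalg (law X) Hist = Hist
     \<and> (\<forall>t\<ge>t0. steer X t \<in> borel_measurable (info X (t - 1))
            \<and> innov X t \<in> borel_measurable (info X t)
            \<and> cond_centered (law X) (info X (t - 1)) (innov X t))
     \<and> (\<forall>t\<ge>t0. \<forall>\<omega>\<in>space (law X).
            disp X (Suc t) \<omega> = disp X t \<omega> + dt *\<^sub>R vel X t \<omega>
          \<and> vel X (Suc t) \<omega> = vel X t \<omega> + (steer X (Suc t) \<omega> + innov X (Suc t) \<omega>))
     \<and> (\<forall>j>t0. AE \<omega> in Hist. nn_cond_exp (law X) Hist
            (\<lambda>\<omega>. ennreal (norm (steer X j \<omega>) + norm (innov X j \<omega>))) \<omega> < \<infinity>)"

text \<open>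
  \<^term>\<open>X\<close> is the perturbed and \<^term>\<open>Y\<close> the unperturbed continuation; \<^term>\<open>p\<close> is the part of the
  impulse that is retained in the velocity at onset.
\<close>

definition impulse_comparison ::
    "real \<Rightarrow> nat \<Rightarrow> 'a measure \<Rightarrow> real^3 \<Rightarrow> 'a continuation \<Rightarrow> 'a continuation \<Rightarrow> bool" where
  "impulse_comparison dt t0 Hist p X Y \<longleftrightarrow>
     continuation_model dt t0 Hist X \<and> continuation_model dt t0 Hist Y
     \<and> disp Y t0 \<in> borel_measurable Hist \<and> vel Y t0 \<in> borel_measurable Hist
     \<and> (\<forall>\<omega>\<in>space Hist. disp X t0 \<omega> = disp Y t0 \<omega> \<and> vel X t0 \<omega> = vel Y t0 \<omega> + p)
     \<and> (\<forall>j>t0. AE \<omega> in Hist.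
          vec_cond_exp (law X) Hist (steer X j) \<omega> = vec_cond_exp (law Y) Hist (steer Y j) \<omega>)"

text \<open>\<^term>\<open>d\<close> is the impulse, along which the displacement coordinate is taken.\<close>

definition level_response ::
    "nat \<Rightarrow> 'a measure \<Rightarrow> real^3 \<Rightarrow> 'a continuation \<Rightarrow> 'a continuation \<Rightarrow> nat \<Rightarrow> 'a \<Rightarrow> real" where
  "level_response t0 Hist d X Y h \<omega> =
     real_cond_exp (law X) Hist (\<lambda>\<omega>. disp X (t0 + h) \<omega> \<bullet> (d /\<^sub>R norm d)) \<omega>
     - real_cond_exp (law Y) Hist (\<lambda>\<omega>. disp Y (t0 + h) \<omega> \<bullet> (d /\<^sub>R norm d)) \<omega>"

definition variance_response ::
    "nat \<Rightarrow> 'a measure \<Rightarrow> 'a continuation \<Rightarrow> 'a continuation \<Rightarrow> nat \<Rightarrow> 'a \<Rightarrow> real" where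
  "variance_response t0 Hist X Y h \<omega> =
     real_cond_exp (law X) Hist (\<lambda>\<omega>. trace (innov_cov X (t0 + h) \<omega>)) \<omega>
     - real_cond_exp (law Y) Hist (\<lambda>\<omega>. trace (innov_cov Y (t0 + h) \<omega>)) \<omega>"

definition inert_regime ::
    "nat \<Rightarrow> 'a measure \<Rightarrow> real^3^3 \<Rightarrow> 'w measure \<Rightarrow> ('w \<Rightarrow> real^3^3)
      \<Rightarrow> 'a continuation \<Rightarrow> (nat \<Rightarrow> 'a \<Rightarrow> 'w) \<Rightarrow> bool" where
  "inert_regime t0 Hist C E G X W \<longleftrightarrow>
     pos_def C \<and> G \<in> borel_measurable E \<and> (\<forall>w\<in>space E. pos_semidef (G w))
     \<and> (\<forall>t\<ge>t0. W t \<in> measurable (info X (t - 1)) E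
            \<and> (AE \<omega> in law X. innov_cov X t \<omega> = C + G (W t \<omega>)))
     \<and> (\<forall>h. AE \<omega> in Hist.
            nn_cond_exp (law X) Hist (\<lambda>\<omega>. ennreal (trace (C + G (W (t0 + h) \<omega>)))) \<omega> < \<infinity>)"

definition same_environment_law ::
    "nat \<Rightarrow> 'a measure \<Rightarrow> 'w measure \<Rightarrow> 'a continuation \<Rightarrow> (nat \<Rightarrow> 'a \<Rightarrow> 'w)
      \<Rightarrow> 'a continuation \<Rightarrow> (nat \<Rightarrow> 'a \<Rightarrow> 'w) \<Rightarrow> bool" where
  "same_environment_law t0 Hist E X WX Y WY \<longleftrightarrow>
     (\<forall>A\<in>sets (PiM (UNIV :: nat set) (\<lambda>_. E)). AE \<omega> in Hist.
        real_cond_exp (law X) Hist (\<lambda>\<omega>. indicator A (\<lambda>h. WX (t0 + h) \<omega>)) \<omega>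
        = real_cond_exp (law Y) Hist (\<lambda>\<omega>. indicator A (\<lambda>h. WY (t0 + h) \<omega>)) \<omega>)"

definition inert_comparison ::
    "real \<Rightarrow> nat \<Rightarrow> 'a measure \<Rightarrow> real^3^3 \<Rightarrow> 'w measure \<Rightarrow> ('w \<Rightarrow> real^3^3) \<Rightarrow> real^3
      \<Rightarrow> 'a continuation \<Rightarrow> (nat \<Rightarrow> 'a \<Rightarrow> 'w) \<Rightarrow> 'a continuation \<Rightarrow> (nat \<Rightarrow> 'a \<Rightarrow> 'w) \<Rightarrow> bool" where
  "inert_comparison dt t0 Hist C E G d X WX Y WY \<longleftrightarrow>
     impulse_comparison dt t0 Hist d X Y
     \<and> inert_regime t0 Hist C E G X WX \<and> inert_regime t0 Hist C E G Y WY
     \<and> same_environment_law t0 Hist E X WX Y WY"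

text \<open>
  \<^term>\<open>K h\<close> is the gain at time \<open>t0 + h\<close>.  A gain that is nonrandom given the history is one that is
  measurable with respect to \<^term>\<open>Hist\<close>; constant schedules are a special case.
\<close>

definition stabilized_regime ::
    "nat \<Rightarrow> 'a measure \<Rightarrow> real \<Rightarrow> real^3^3 \<Rightarrow> 'a continuation \<Rightarrow> (nat \<Rightarrow> 'a \<Rightarrow> real)
      \<Rightarrow> (nat \<Rightarrow> 'a \<Rightarrow> real^3) \<Rightarrow> (nat \<Rightarrow> 'a \<Rightarrow> real^3) \<Rightarrow> bool" where
  "stabilized_regime t0 Hist lam \<Sigma> X K \<zeta> \<nu> \<longleftrightarrow>
     pos_def \<Sigma> \<and> (\<forall>h. K h \<in> borel_measurable Hist)
     \<and> (\<forall>t\<ge>t0. cond_centered (law X) (info X (t - 1)) (\<zeta> t)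
            \<and> cond_centered (law X) (info X (t - 1)) (\<nu> t)
            \<and> cond_indep (law X) (info X (t - 1)) (\<zeta> t) (\<nu> t)
            \<and> (AE \<omega> in law X. cond_cov (law X) (info X (t - 1))
                  (\<lambda>\<omega>. (1 - lam) *\<^sub>R \<zeta> t \<omega> + lam *\<^sub>R \<nu> t \<omega>) \<omega> = \<Sigma>))
     \<and> (\<forall>h. \<forall>\<omega>\<in>space (law X). innov X (t0 + h) \<omega> =
            (1 - K h \<omega>) *\<^sub>R ((1 - lam) *\<^sub>R \<zeta> (t0 + h) \<omega> + lam *\<^sub>R \<nu> (t0 + h) \<omega>))"

definition stabilized_comparison ::
    "real \<Rightarrow> nat \<Rightarrow> 'a measure \<Rightarrow> real \<Rightarrow> real \<Rightarrow> real^3^3 \<Rightarrow> real^3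
      \<Rightarrow> 'a continuation \<Rightarrow> (nat \<Rightarrow> 'a \<Rightarrow> real) \<Rightarrow> (nat \<Rightarrow> 'a \<Rightarrow> real^3) \<Rightarrow> (nat \<Rightarrow> 'a \<Rightarrow> real^3)
      \<Rightarrow> 'a continuation \<Rightarrow> (nat \<Rightarrow> 'a \<Rightarrow> real) \<Rightarrow> (nat \<Rightarrow> 'a \<Rightarrow> real^3) \<Rightarrow> (nat \<Rightarrow> 'a \<Rightarrow> real^3)
      \<Rightarrow> bool" where
  "stabilized_comparison dt t0 Hist \<eta> lam \<Sigma> d X KX \<zeta>X \<nu>X Y KY \<zeta>Y \<nu>Y \<longleftrightarrow>
     impulse_comparison dt t0 Hist (\<eta> *\<^sub>R d) X Y
     \<and> stabilized_regime t0 Hist lam \<Sigma> X KX \<zeta>X \<nu>X \<and> stabilized_regime t0 Hist lam \<Sigma> Y KY \<zeta>Y \<nu>Y"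

text \<open>
  Convergence of the gain to \<^term>\<open>Kmax\<close> belongs to the idealized continuation of the schedule and is
  not part of the episode itself.
\<close>

definition gain_episode :: "'a measure \<Rightarrow> real \<Rightarrow> (nat \<Rightarrow> 'a \<Rightarrow> real) \<Rightarrow> bool" where
  "gain_episode Hist Kmax K \<longleftrightarrow> 0 < Kmax \<and> Kmax < 1
     \<and> (\<forall>\<omega>\<in>space Hist. K 0 \<omega> = 0 \<and> incseq (\<lambda>h. K h \<omega>) \<and> (\<forall>h. K h \<omega> \<le> Kmax))"

end

theory Submission
  imports Defs
begin

text \<open>
Conditional means given the history obey the noise-free recursion.  An innovation is centered given
the information one step earlier, which contains the history, so the tower property removes it from
the conditional mean; the mean steering agrees in the two continuations and cancels in the
difference.  The difference of the mean velocities therefore stays equal to the retained impulse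
\<open>p\<close>, the difference of the mean displacements gains \<open>dt * p\<close> per step, and the level response
after \<open>h\<close> steps is \<open>h * dt\<close> times the component of \<open>p\<close> along the impulse
(\<open>level_response_impulse\<close>).  The two continuations have different laws, and only conditional
integrability is available.  Hence conditional expectations are first shown to be linear for
functions whose absolute value has an almost surely finite conditional expectation, and the induction
over \<open>h\<close> runs on the relation \<open>mean_shift\<close>, which is closed under linear combinations.

In the inert regime the innovation covariance is a function of the environment alone.  Equal
conditional laws of the environment make the two measures obtained by weighting the laws with this
function agree on the history; the Radon-Nikodym densities that define the conditional expectations
then coincide, and the variance response vanishes.

In the stabilized regime the gain is known one step ahead, so the covariance of the innovation is
\<open>(1 - K)\<^sup>2 \<Sigma>\<close> (\<open>stabilized_innov_cov\<close>), a function of the history.  The variance response is the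
difference of these factors times the trace of \<open>\<Sigma>\<close>, which is positive; monotonicity, sign and limit
are facts about the polynomial \<open>(1 - K)\<^sup>2 - 1\<close> on \<open>K < 1\<close>.

For the ambiguity of the retained slope an inert comparison with impulse \<open>\<eta> *\<^sub>R d\<close> is exhibited.
The unperturbed stabilized continuation has gain 0 and constant covariance \<open>\<Sigma>\<close>, so it is inert with
\<open>C = \<Sigma>\<close> and \<open>G = 0\<close>; translating its velocity by the retained impulse gives the partner.
\<close>

section \<open>Conditional expectations without integrability\<close>

text \<open>
The condition under which \<^const>\<open>real_cond_exp\<close> is a genuine difference of finite quantities; it is
weaker than integrability, and linearity still holds under it.
\<close>

definition cond_integrable :: "'a measure \<Rightarrow> 'a measure \<Rightarrow> ('a \<Rightarrow> real) \<Rightarrow> bool" where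
  "cond_integrable M F f \<longleftrightarrow> f \<in> borel_measurable M
     \<and> (AE x in M. nn_cond_exp M F (\<lambda>x. ennreal \<bar>f x\<bar>) x < \<infinity>)"

lemma borel_measurable_vec_nth [measurable (raw)]:
  fixes f :: "'a \<Rightarrow> 'b::topological_space^'n"
  shows "f \<in> borel_measurable M \<Longrightarrow> (\<lambda>x. f x $ i) \<in> borel_measurable M"
  by (rule measurable_compose[OF _ borel_measurable_continuous_onI])
    (auto intro: continuous_intros)

context sigma_finite_subalgebra
begin

text \<open>
The positive and negative parts may be replaced by any other decomposition of \<open>f\<close> into nonnegative
functions: \<open>f\<^sup>+ + b = f\<^sup>- + a\<close> is an identity between nonnegative functions, conditional expectations
of such sums add up, and finiteness permits the subtraction.
\<close>

lemma real_cond_exp_as_difference: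
  assumes [measurable]: "f \<in> borel_measurable M" "a \<in> borel_measurable M" "b \<in> borel_measurable M"
    and f: "\<And>x. f x = a x - b x" and nonneg: "\<And>x. 0 \<le> a x" "\<And>x. 0 \<le> b x"
    and fin: "AE x in M. nn_cond_exp M F (\<lambda>x. ennreal (a x)) x < \<infinity>"
      "AE x in M. nn_cond_exp M F (\<lambda>x. ennreal (b x)) x < \<infinity>"
  shows "cond_integrable M F f" (is ?int)
    and "AE x in M. real_cond_exp M F f x
       = enn2real (nn_cond_exp M F (\<lambda>x. ennreal (a x)) x)
         - enn2real (nn_cond_exp M F (\<lambda>x. ennreal (b x)) x)" (is ?eq)
proof -
  let ?N = "nn_cond_exp M F"
  have "AE x in M. ?N (\<lambda>x. ennreal (a x)) x + ?N (\<lambda>x. ennreal (b x)) x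
      = ?N (\<lambda>x. ennreal (a x) + ennreal (b x)) x"
    by (rule nn_cond_exp_sum) auto
  moreover have "AE x in M. ?N (\<lambda>x. ennreal \<bar>f x\<bar>) x \<le> ?N (\<lambda>x. ennreal (a x) + ennreal (b x)) x"
    by (rule nn_cond_exp_mono)
      (auto simp: f nonneg ennreal_plus[symmetric] simp del: ennreal_plus intro!: ennreal_leI
        order_trans[OF abs_triangle_ineq4])
  moreover note fin
  ultimately have abs_fin: "AE x in M. ?N (\<lambda>x. ennreal \<bar>f x\<bar>) x < \<infinity>"
  proof eventually_elim
    case (elim x)
    have "?N (\<lambda>x. ennreal (a x) + ennreal (b x)) x < \<infinity>"
      using elim(3,4) elim(1) by (metis ennreal_add_less_top infinity_ennreal_def)
    then show ?case using elim(2) by (rule le_less_trans[rotated])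
  qed
  then show ?int by (simp add: cond_integrable_def)
  have swap: "(\<lambda>x. ennreal (f x) + ennreal (b x)) = (\<lambda>x. ennreal (- f x) + ennreal (a x))"
  proof
    fix x
    show "ennreal (f x) + ennreal (b x) = ennreal (- f x) + ennreal (a x)"
    proof (cases "0 \<le> f x")
      case True
      then show ?thesis using nonneg[of x] f[of x]
        by (simp add: ennreal_plus[symmetric] ennreal_neg del: ennreal_plus)
    next
      case False
      then show ?thesis using nonneg[of x] f[of x]
        by (simp add: ennreal_plus[symmetric] ennreal_neg del: ennreal_plus)
    qed
  qed
  have "AE x in M. ?N (\<lambda>x. ennreal (f x)) x \<le> ?N (\<lambda>x. ennreal \<bar>f x\<bar>) x"
    by (rule nn_cond_exp_mono) (auto intro!: ennreal_leI)
  moreover have "AE x in M. ?N (\<lambda>x. ennreal (- f x)) x \<le> ?N (\<lambda>x. ennreal \<bar>f x\<bar>) x"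
    by (rule nn_cond_exp_mono) (auto intro!: ennreal_leI)
  moreover have "AE x in M. ?N (\<lambda>x. ennreal (f x)) x + ?N (\<lambda>x. ennreal (b x)) x
      = ?N (\<lambda>x. ennreal (f x) + ennreal (b x)) x"
    by (rule nn_cond_exp_sum) auto
  moreover have "AE x in M. ?N (\<lambda>x. ennreal (- f x)) x + ?N (\<lambda>x. ennreal (a x)) x
      = ?N (\<lambda>x. ennreal (- f x) + ennreal (a x)) x"
    by (rule nn_cond_exp_sum) auto
  moreover note abs_fin fin
  ultimately show ?eq
  proof eventually_elim
    case (elim x)
    have *: "?N (\<lambda>x. ennreal (f x)) x < \<infinity>" "?N (\<lambda>x. ennreal (- f x)) x < \<infinity>"
      using elim(1,2,5) le_less_trans by blast+
    have "?N (\<lambda>x. ennreal (f x)) x + ?N (\<lambda>x. ennreal (b x)) x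
        = ?N (\<lambda>x. ennreal (- f x)) x + ?N (\<lambda>x. ennreal (a x)) x"
      using elim(3,4) by (simp add: swap)
    then have "enn2real (?N (\<lambda>x. ennreal (f x)) x) + enn2real (?N (\<lambda>x. ennreal (b x)) x)
        = enn2real (?N (\<lambda>x. ennreal (- f x)) x) + enn2real (?N (\<lambda>x. ennreal (a x)) x)"
      using * elim(6,7) by (metis enn2real_plus infinity_ennreal_def)
    then show ?case by (simp add: real_cond_exp_def)
  qed
qed

lemma cond_integrable_parts:
  assumes "cond_integrable M F f"
  shows "AE x in M. nn_cond_exp M F (\<lambda>x. ennreal (f x)) x < \<infinity>"
    and "AE x in M. nn_cond_exp M F (\<lambda>x. ennreal (- f x)) x < \<infinity>"
proof -
  have [measurable]: "f \<in> borel_measurable M"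
    and fin: "AE x in M. nn_cond_exp M F (\<lambda>x. ennreal \<bar>f x\<bar>) x < \<infinity>"
    using assms by (auto simp: cond_integrable_def)
  have "AE x in M. nn_cond_exp M F (\<lambda>x. ennreal (f x)) x
      \<le> nn_cond_exp M F (\<lambda>x. ennreal \<bar>f x\<bar>) x"
    by (rule nn_cond_exp_mono) (auto intro!: ennreal_leI)
  with fin show "AE x in M. nn_cond_exp M F (\<lambda>x. ennreal (f x)) x < \<infinity>"
    by eventually_elim (rule le_less_trans)
  have "AE x in M. nn_cond_exp M F (\<lambda>x. ennreal (- f x)) x
      \<le> nn_cond_exp M F (\<lambda>x. ennreal \<bar>f x\<bar>) x"
    by (rule nn_cond_exp_mono) (auto intro!: ennreal_leI)
  with fin show "AE x in M. nn_cond_exp M F (\<lambda>x. ennreal (- f x)) x < \<infinity>"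
    by eventually_elim (rule le_less_trans)
qed

lemma cond_integrable_add:
  assumes f: "cond_integrable M F f" and g: "cond_integrable M F g"
  shows "cond_integrable M F (\<lambda>x. f x + g x)"
    and "AE x in M. real_cond_exp M F (\<lambda>x. f x + g x) x
           = real_cond_exp M F f x + real_cond_exp M F g x"
proof -
  have [measurable]: "f \<in> borel_measurable M" "g \<in> borel_measurable M"
    using f g by (auto simp: cond_integrable_def)
  let ?N = "nn_cond_exp M F"
  define a where "a = (\<lambda>x. max (f x) 0 + max (g x) 0)"
  define b where "b = (\<lambda>x. max (- f x) 0 + max (- g x) 0)"
  have [measurable]: "a \<in> borel_measurable M" "b \<in> borel_measurable M"
    unfolding a_def b_def by auto
  have max0: "ennreal (max y 0) = ennreal y" for y
    by (cases "0 \<le> y") (auto simp: max_def ennreal_neg)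
  have ab: "(\<lambda>x. ennreal (a x)) = (\<lambda>x. ennreal (f x) + ennreal (g x))"
    "(\<lambda>x. ennreal (b x)) = (\<lambda>x. ennreal (- f x) + ennreal (- g x))"
    by (auto simp: a_def b_def max0)
  have A: "AE x in M. ?N (\<lambda>x. ennreal (f x)) x + ?N (\<lambda>x. ennreal (g x)) x
      = ?N (\<lambda>x. ennreal (a x)) x"
    unfolding ab by (rule nn_cond_exp_sum) auto
  have B: "AE x in M. ?N (\<lambda>x. ennreal (- f x)) x + ?N (\<lambda>x. ennreal (- g x)) x
      = ?N (\<lambda>x. ennreal (b x)) x"
    unfolding ab by (rule nn_cond_exp_sum) auto
  note pf = cond_integrable_parts[OF f] and pg = cond_integrable_parts[OF g]
  have fin_a: "AE x in M. ?N (\<lambda>x. ennreal (a x)) x < \<infinity>"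
    using A pf(1) pg(1)
    by eventually_elim (metis ennreal_add_less_top infinity_ennreal_def)
  have fin_b: "AE x in M. ?N (\<lambda>x. ennreal (b x)) x < \<infinity>"
    using B pf(2) pg(2)
    by eventually_elim (metis ennreal_add_less_top infinity_ennreal_def)
  have diff: "f x + g x = a x - b x" for x by (auto simp: a_def b_def max_def)
  have nonneg: "0 \<le> a x" "0 \<le> b x" for x by (auto simp: a_def b_def)
  show "cond_integrable M F (\<lambda>x. f x + g x)"
    by (rule real_cond_exp_as_difference(1)[of _ a b]) (use diff nonneg fin_a fin_b in auto)
  have "AE x in M. real_cond_exp M F (\<lambda>x. f x + g x) x
      = enn2real (?N (\<lambda>x. ennreal (a x)) x) - enn2real (?N (\<lambda>x. ennreal (b x)) x)"
    by (rule real_cond_exp_as_difference(2)[of _ a b]) (use diff nonneg fin_a fin_b in auto)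
  then show "AE x in M. real_cond_exp M F (\<lambda>x. f x + g x) x
           = real_cond_exp M F f x + real_cond_exp M F g x"
    using A B pf pg
  proof eventually_elim
    case (elim x)
    have "enn2real (?N (\<lambda>x. ennreal (a x)) x)
        = enn2real (?N (\<lambda>x. ennreal (f x)) x) + enn2real (?N (\<lambda>x. ennreal (g x)) x)"
      using elim(2,4,6) by (metis enn2real_plus infinity_ennreal_def)
    moreover have "enn2real (?N (\<lambda>x. ennreal (b x)) x)
        = enn2real (?N (\<lambda>x. ennreal (- f x)) x) + enn2real (?N (\<lambda>x. ennreal (- g x)) x)"
      using elim(3,5,7) by (metis enn2real_plus infinity_ennreal_def)
    ultimately show ?case using elim(1) by (simp add: real_cond_exp_def)
  qed
qed

text \<open>
A nonnegative multiplier acts on the positive and the negative part separately, and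
\<^const>\<open>enn2real\<close> is multiplicative even at infinity, so the identity holds for every measurable \<open>f\<close>.
\<close>

lemma real_cond_exp_mult_nonneg:
  assumes [measurable]: "c \<in> borel_measurable F" "f \<in> borel_measurable M" and c: "\<And>x. 0 \<le> c x"
  shows "AE x in M. real_cond_exp M F (\<lambda>x. c x * f x) x = c x * real_cond_exp M F f x"
proof -
  have parts: "(\<lambda>x. ennreal (c x * f x)) = (\<lambda>x. ennreal (c x) * ennreal (f x))"
    "(\<lambda>x. ennreal (- (c x * f x))) = (\<lambda>x. ennreal (c x) * ennreal (- f x))"
    by (simp_all only: mult_minus_right[symmetric] ennreal_mult'[OF c])
  have "AE x in M. ennreal (c x) * nn_cond_exp M F (\<lambda>x. ennreal (f x)) x
      = nn_cond_exp M F (\<lambda>x. ennreal (c x) * ennreal (f x)) x"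
    by (rule nn_cond_exp_prod) auto
  moreover have "AE x in M. ennreal (c x) * nn_cond_exp M F (\<lambda>x. ennreal (- f x)) x
      = nn_cond_exp M F (\<lambda>x. ennreal (c x) * ennreal (- f x)) x"
    by (rule nn_cond_exp_prod) auto
  ultimately show ?thesis
  proof eventually_elim
    case (elim x)
    show ?case
      unfolding real_cond_exp_def parts elim[symmetric]
      by (simp add: enn2real_mult c right_diff_distrib)
  qed
qed

lemma cond_integrable_cmult:
  assumes f: "cond_integrable M F f"
  shows "cond_integrable M F (\<lambda>x. c * f x)"
    and "AE x in M. real_cond_exp M F (\<lambda>x. c * f x) x = c * real_cond_exp M F f x"
proof -
  have [measurable]: "f \<in> borel_measurable M"
    and fin: "AE x in M. nn_cond_exp M F (\<lambda>x. ennreal \<bar>f x\<bar>) x < \<infinity>"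
    using f by (auto simp: cond_integrable_def)
  have "AE x in M. ennreal \<bar>c\<bar> * nn_cond_exp M F (\<lambda>x. ennreal \<bar>f x\<bar>) x
      = nn_cond_exp M F (\<lambda>x. ennreal \<bar>c\<bar> * ennreal \<bar>f x\<bar>) x"
    by (rule nn_cond_exp_prod) auto
  with fin have "AE x in M. nn_cond_exp M F (\<lambda>x. ennreal \<bar>c\<bar> * ennreal \<bar>f x\<bar>) x < \<infinity>"
    by eventually_elim (metis ennreal_less_top ennreal_mult_less_top infinity_ennreal_def)
  then have "AE x in M. nn_cond_exp M F (\<lambda>x. ennreal \<bar>c * f x\<bar>) x < \<infinity>"
    by (simp add: abs_mult ennreal_mult)
  then show "cond_integrable M F (\<lambda>x. c * f x)" by (simp add: cond_integrable_def)
  show "AE x in M. real_cond_exp M F (\<lambda>x. c * f x) x = c * real_cond_exp M F f x"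
  proof (cases "0 \<le> c")
    case True
    then show ?thesis using real_cond_exp_mult_nonneg[of "\<lambda>_. c" f] by simp
  next
    case False
    have "AE x in M. real_cond_exp M F (\<lambda>x. - c * (- f x)) x = - c * real_cond_exp M F (\<lambda>x. - f x) x"
      using real_cond_exp_mult_nonneg[of "\<lambda>_. - c" "\<lambda>x. - f x"] False by simp
    moreover have "real_cond_exp M F (\<lambda>x. - f x) x = - real_cond_exp M F f x" for x
      by (simp add: real_cond_exp_def)
    ultimately show ?thesis by simp
  qed
qed

lemma real_cond_exp_subalg_measurable:
  assumes [measurable]: "f \<in> borel_measurable F"
  shows "cond_integrable M F f" and "AE x in M. real_cond_exp M F f x = f x"
proof -
  have [measurable]: "f \<in> borel_measurable M" by (rule measurable_from_subalg[OF subalg assms])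
  have "AE x in M. ennreal \<bar>f x\<bar> = nn_cond_exp M F (\<lambda>x. ennreal \<bar>f x\<bar>) x"
    by (rule nn_cond_exp_F_meas) auto
  then have "AE x in M. nn_cond_exp M F (\<lambda>x. ennreal \<bar>f x\<bar>) x < \<infinity>"
    by eventually_elim (erule subst, simp)
  then show "cond_integrable M F f" by (simp add: cond_integrable_def)
  have "AE x in M. ennreal (f x) = nn_cond_exp M F (\<lambda>x. ennreal (f x)) x"
    "AE x in M. ennreal (- f x) = nn_cond_exp M F (\<lambda>x. ennreal (- f x)) x"
    by (rule nn_cond_exp_F_meas; auto)+
  then show "AE x in M. real_cond_exp M F f x = f x"
  proof eventually_elim
    case (elim x)
    then have "real_cond_exp M F f x = enn2real (ennreal (f x)) - enn2real (ennreal (- f x))"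
      by (simp only: real_cond_exp_def)
    then show ?case by (cases "0 \<le> f x") (simp_all add: ennreal_neg)
  qed
qed

text \<open>
Conditional centering passes to a coarser sub-sigma-algebra: given \<open>G\<close> the positive and negative
parts have equal conditional expectations, and the tower property for nonnegative functions transfers
this equality to \<open>F\<close>.
\<close>

lemma real_cond_exp_zero_tower:
  assumes sub: "subalgebra M G" "subalgebra G F" and f: "cond_integrable M G f"
    and zero: "AE x in M. real_cond_exp M G f x = 0"
  shows "AE x in M. real_cond_exp M F f x = 0"
proof -
  interpret G: sigma_finite_subalgebra M G by (rule nested_subalg_is_sigma_finite[OF sub])
  have [measurable]: "f \<in> borel_measurable M" using f by (simp add: cond_integrable_def)
  have "AE x in M. nn_cond_exp M G (\<lambda>x. ennreal (f x)) x = nn_cond_exp M G (\<lambda>x. ennreal (- f x)) x"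
    using zero G.cond_integrable_parts[OF f]
  proof eventually_elim
    case (elim x)
    then have "ennreal (enn2real (nn_cond_exp M G (\<lambda>x. ennreal (f x)) x))
        = ennreal (enn2real (nn_cond_exp M G (\<lambda>x. ennreal (- f x)) x))"
      by (simp add: real_cond_exp_def)
    then show ?case using elim(2,3) by (metis ennreal_enn2real infinity_ennreal_def)
  qed
  then have "AE x in M. nn_cond_exp M F (nn_cond_exp M G (\<lambda>x. ennreal (f x))) x
      = nn_cond_exp M F (nn_cond_exp M G (\<lambda>x. ennreal (- f x))) x"
    by (rule nn_cond_exp_cong) auto
  moreover have "AE x in M. nn_cond_exp M F (\<lambda>x. ennreal (f x)) x
      = nn_cond_exp M F (nn_cond_exp M G (\<lambda>x. ennreal (f x))) x"
    by (rule nn_cond_exp_nested_subalg[OF sub]) auto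
  moreover have "AE x in M. nn_cond_exp M F (\<lambda>x. ennreal (- f x)) x
      = nn_cond_exp M F (nn_cond_exp M G (\<lambda>x. ennreal (- f x))) x"
    by (rule nn_cond_exp_nested_subalg[OF sub]) auto
  ultimately show ?thesis by eventually_elim (simp add: real_cond_exp_def)
qed

lemma cond_integrable_bound:
  assumes [measurable]: "f \<in> borel_measurable M" "u \<in> borel_measurable M"
    and le: "AE x in M. ennreal \<bar>f x\<bar> \<le> u x"
    and fin: "AE x in M. nn_cond_exp M F u x < \<infinity>"
  shows "cond_integrable M F f"
proof -
  have "AE x in M. nn_cond_exp M F (\<lambda>x. ennreal \<bar>f x\<bar>) x \<le> nn_cond_exp M F u x"
    by (rule nn_cond_exp_mono[OF le]) auto
  with fin have "AE x in M. nn_cond_exp M F (\<lambda>x. ennreal \<bar>f x\<bar>) x < \<infinity>"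
    by eventually_elim (rule le_less_trans)
  then show ?thesis by (simp add: cond_integrable_def)
qed

text \<open>
Finite conditional second moments give conditional integrability because
\<open>\<bar>x\<bar> \<le> 1 + x\<^sup>2\<close>.
\<close>

lemma cond_centered_components:
  fixes X :: "'a \<Rightarrow> real^'n"
  assumes "cond_centered M F X"
  shows "cond_integrable M F (\<lambda>\<omega>. X \<omega> $ i)"
    and "AE \<omega> in M. real_cond_exp M F (\<lambda>\<omega>. X \<omega> $ i) \<omega> = 0"
proof -
  have [measurable]: "X \<in> borel_measurable M"
    and sq: "AE \<omega> in M. nn_cond_exp M F (\<lambda>\<omega>. ennreal ((norm (X \<omega>))\<^sup>2)) \<omega> < \<infinity>"
    and zero: "AE \<omega> in M. vec_cond_exp M F X \<omega> = 0"
    using assms by (auto simp: cond_centered_def)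
  have one: "AE \<omega> in M. (1::ennreal) = nn_cond_exp M F (\<lambda>_. 1) \<omega>"
    by (rule nn_cond_exp_F_meas) auto
  have sum: "AE \<omega> in M. nn_cond_exp M F (\<lambda>_. 1) \<omega> + nn_cond_exp M F (\<lambda>\<omega>. ennreal ((norm (X \<omega>))\<^sup>2)) \<omega>
      = nn_cond_exp M F (\<lambda>\<omega>. 1 + ennreal ((norm (X \<omega>))\<^sup>2)) \<omega>"
    by (rule nn_cond_exp_sum) auto
  show "cond_integrable M F (\<lambda>\<omega>. X \<omega> $ i)"
  proof (rule cond_integrable_bound)
    show "AE \<omega> in M. nn_cond_exp M F (\<lambda>\<omega>. 1 + ennreal ((norm (X \<omega>))\<^sup>2)) \<omega> < \<infinity>"
      using one sum sq
      by eventually_elim (metis ennreal_add_less_top ennreal_one_less_top infinity_ennreal_def)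
    have "\<bar>X \<omega> $ i\<bar> \<le> 1 + (norm (X \<omega>))\<^sup>2" for \<omega>
    proof -
      have "\<bar>X \<omega> $ i\<bar> \<le> norm (X \<omega>)" by (rule component_le_norm_cart)
      also have "\<dots> \<le> 1 + (norm (X \<omega>))\<^sup>2"
        \<comment> \<open>\<open>(x - 1)\<^sup>2 \<ge> 0\<close> and \<open>x \<ge> 0\<close> give \<open>x \<le> 1 + x\<^sup>2\<close>\<close>
        using zero_le_power2[of "norm (X \<omega>) - 1"] norm_ge_zero[of "X \<omega>"]
        unfolding power2_diff one_power2 by linarith
      finally show ?thesis .
    qed
    then have "ennreal \<bar>X \<omega> $ i\<bar> \<le> 1 + ennreal ((norm (X \<omega>))\<^sup>2)" for \<omega>
      using ennreal_leI[of "\<bar>X \<omega> $ i\<bar>" "1 + (norm (X \<omega>))\<^sup>2"] by (simp add: ennreal_plus)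
    then show "AE \<omega> in M. ennreal \<bar>X \<omega> $ i\<bar> \<le> 1 + ennreal ((norm (X \<omega>))\<^sup>2)" by simp
  qed measurable
  show "AE \<omega> in M. real_cond_exp M F (\<lambda>\<omega>. X \<omega> $ i) \<omega> = 0"
    using zero by eventually_elim (simp add: vec_cond_exp_def vec_eq_iff)
qed

lemma cond_cov_zero_mean:
  fixes X :: "'a \<Rightarrow> real^'n"
  assumes [measurable]: "X \<in> borel_measurable M" and zero: "AE \<omega> in M. vec_cond_exp M F X \<omega> = 0"
  shows "AE \<omega> in M. \<forall>i k. cond_cov M F X \<omega> $ i $ k = real_cond_exp M F (\<lambda>\<omega>. X \<omega> $ i * X \<omega> $ k) \<omega>"
proof -
  have [measurable]: "(\<lambda>\<omega>. vec_cond_exp M F X \<omega> $ i) \<in> borel_measurable M" for i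
    by (simp add: vec_cond_exp_def)
  have "AE \<omega> in M. cond_cov M F X \<omega> $ i $ k = real_cond_exp M F (\<lambda>\<omega>. X \<omega> $ i * X \<omega> $ k) \<omega>" for i k
    unfolding cond_cov_def vec_lambda_beta
    by (rule real_cond_exp_cong) (use zero in \<open>auto elim!: eventually_mono\<close>)
  then show ?thesis by (simp add: AE_all_countable)
qed

text \<open>
For centered vectors the covariance is the conditional mean of products, out of which the nonnegative
factor \<open>c\<^sup>2\<close> is pulled.
\<close>

lemma cond_cov_scale:
  fixes X R :: "'a \<Rightarrow> real^'n"
  assumes [measurable]: "X \<in> borel_measurable M" "R \<in> borel_measurable M" "c \<in> borel_measurable F"
    and X: "\<And>\<omega>. \<omega> \<in> space M \<Longrightarrow> X \<omega> = c \<omega> *\<^sub>R R \<omega>"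
    and zero: "AE \<omega> in M. vec_cond_exp M F X \<omega> = 0" "AE \<omega> in M. vec_cond_exp M F R \<omega> = 0"
  shows "AE \<omega> in M. cond_cov M F X \<omega> = (c \<omega>)\<^sup>2 *\<^sub>R cond_cov M F R \<omega>"
proof -
  have [measurable]: "c \<in> borel_measurable M" by (rule measurable_from_subalg[OF subalg assms(3)])
  have "AE \<omega> in M. real_cond_exp M F (\<lambda>\<omega>. X \<omega> $ i * X \<omega> $ k) \<omega>
      = (c \<omega>)\<^sup>2 * real_cond_exp M F (\<lambda>\<omega>. R \<omega> $ i * R \<omega> $ k) \<omega>" for i k
  proof -
    have "AE \<omega> in M. real_cond_exp M F (\<lambda>\<omega>. X \<omega> $ i * X \<omega> $ k) \<omega>
        = real_cond_exp M F (\<lambda>\<omega>. (c \<omega>)\<^sup>2 * (R \<omega> $ i * R \<omega> $ k)) \<omega>"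
      by (rule real_cond_exp_cong) (auto simp: X power2_eq_square ac_simps)
    moreover have "AE \<omega> in M. real_cond_exp M F (\<lambda>\<omega>. (c \<omega>)\<^sup>2 * (R \<omega> $ i * R \<omega> $ k)) \<omega>
        = (c \<omega>)\<^sup>2 * real_cond_exp M F (\<lambda>\<omega>. R \<omega> $ i * R \<omega> $ k) \<omega>"
      by (rule real_cond_exp_mult_nonneg) auto
    ultimately show ?thesis by eventually_elim simp
  qed
  then have "AE \<omega> in M. \<forall>i k. real_cond_exp M F (\<lambda>\<omega>. X \<omega> $ i * X \<omega> $ k) \<omega>
      = (c \<omega>)\<^sup>2 * real_cond_exp M F (\<lambda>\<omega>. R \<omega> $ i * R \<omega> $ k) \<omega>"
    by (simp add: AE_all_countable)
  then show ?thesis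
    using cond_cov_zero_mean[OF assms(1) zero(1)] cond_cov_zero_mean[OF assms(2) zero(2)]
    by eventually_elim (simp add: vec_eq_iff)
qed

end

section \<open>Two laws over a common history\<close>

text \<open>
Both laws restrict to the measure \<open>H\<close> itself, so that conditional expectations under the two laws are
functions on one measure space and can be compared almost everywhere there.
\<close>

locale common_history =
  X: sigma_finite_subalgebra MX H + Y: sigma_finite_subalgebra MY H for MX MY H :: "'a measure" +
  assumes restr_X: "restr_to_subalg MX H = H" and restr_Y: "restr_to_subalg MY H = H"
begin

lemma AE_law_iff_AE_history:
  assumes "Measurable.pred H P"
  shows "(AE \<omega> in MX. P \<omega>) \<longleftrightarrow> (AE \<omega> in H. P \<omega>)" "(AE \<omega> in MY. P \<omega>) \<longleftrightarrow> (AE \<omega> in H. P \<omega>)"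
proof -
  have iff: "(AE \<omega> in M. P \<omega>) \<longleftrightarrow> (AE \<omega> in H. P \<omega>)"
    if "subalgebra M H" "restr_to_subalg M H = H" for M
    using AE_restr_to_subalg[OF that(1), of P] AE_restr_to_subalg2[OF that(1) _ assms]
    unfolding that(2) by (rule iffI[rotated])
  show "(AE \<omega> in MX. P \<omega>) \<longleftrightarrow> (AE \<omega> in H. P \<omega>)" by (rule iff[OF X.subalg restr_X])
  show "(AE \<omega> in MY. P \<omega>) \<longleftrightarrow> (AE \<omega> in H. P \<omega>)" by (rule iff[OF Y.subalg restr_Y])
qed

text \<open>
The invariant of the induction over the response horizon.  It is closed under linear combinations, so it
follows the linear dynamics step by step.
\<close>

definition mean_shift :: "('a \<Rightarrow> real) \<Rightarrow> ('a \<Rightarrow> real) \<Rightarrow> real \<Rightarrow> bool" where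
  "mean_shift f g c \<longleftrightarrow> cond_integrable MX H f \<and> cond_integrable MY H g
     \<and> (AE \<omega> in H. real_cond_exp MX H f \<omega> = real_cond_exp MY H g \<omega> + c)"

lemma AE_history_cond_exp:
  assumes [measurable]: "f \<in> borel_measurable H"
  shows "(AE \<omega> in MX. real_cond_exp MX H u \<omega> = f \<omega>) \<Longrightarrow> AE \<omega> in H. real_cond_exp MX H u \<omega> = f \<omega>"
    and "(AE \<omega> in MY. real_cond_exp MY H u \<omega> = f \<omega>) \<Longrightarrow> AE \<omega> in H. real_cond_exp MY H u \<omega> = f \<omega>"
  by (subst (asm) AE_law_iff_AE_history; measurable)+

lemma mean_shift_add:
  assumes 1: "mean_shift f1 g1 c1" and 2: "mean_shift f2 g2 c2"
  shows "mean_shift (\<lambda>\<omega>. f1 \<omega> + f2 \<omega>) (\<lambda>\<omega>. g1 \<omega> + g2 \<omega>) (c1 + c2)"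
proof -
  have i: "cond_integrable MX H f1" "cond_integrable MX H f2"
    "cond_integrable MY H g1" "cond_integrable MY H g2"
    and e: "AE \<omega> in H. real_cond_exp MX H f1 \<omega> = real_cond_exp MY H g1 \<omega> + c1"
      "AE \<omega> in H. real_cond_exp MX H f2 \<omega> = real_cond_exp MY H g2 \<omega> + c2"
    using 1 2 by (auto simp: mean_shift_def)
  have "AE \<omega> in H. real_cond_exp MX H (\<lambda>\<omega>. f1 \<omega> + f2 \<omega>) \<omega>
      = real_cond_exp MX H f1 \<omega> + real_cond_exp MX H f2 \<omega>"
    by (rule AE_history_cond_exp(1)[OF _ X.cond_integrable_add(2)[OF i(1,2)]]) measurable
  moreover have "AE \<omega> in H. real_cond_exp MY H (\<lambda>\<omega>. g1 \<omega> + g2 \<omega>) \<omega>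
      = real_cond_exp MY H g1 \<omega> + real_cond_exp MY H g2 \<omega>"
    by (rule AE_history_cond_exp(2)[OF _ Y.cond_integrable_add(2)[OF i(3,4)]]) measurable
  ultimately have "AE \<omega> in H. real_cond_exp MX H (\<lambda>\<omega>. f1 \<omega> + f2 \<omega>) \<omega>
      = real_cond_exp MY H (\<lambda>\<omega>. g1 \<omega> + g2 \<omega>) \<omega> + (c1 + c2)"
    using e by eventually_elim simp
  then show ?thesis
    using X.cond_integrable_add(1)[OF i(1,2)] Y.cond_integrable_add(1)[OF i(3,4)]
    by (simp add: mean_shift_def)
qed

lemma mean_shift_cmult:
  assumes "mean_shift f g c"
  shows "mean_shift (\<lambda>\<omega>. a * f \<omega>) (\<lambda>\<omega>. a * g \<omega>) (a * c)"
proof -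
  have i: "cond_integrable MX H f" "cond_integrable MY H g"
    and e: "AE \<omega> in H. real_cond_exp MX H f \<omega> = real_cond_exp MY H g \<omega> + c"
    using assms by (auto simp: mean_shift_def)
  have "AE \<omega> in H. real_cond_exp MX H (\<lambda>\<omega>. a * f \<omega>) \<omega> = a * real_cond_exp MX H f \<omega>"
    by (rule AE_history_cond_exp(1)[OF _ X.cond_integrable_cmult(2)[OF i(1)]]) measurable
  moreover have "AE \<omega> in H. real_cond_exp MY H (\<lambda>\<omega>. a * g \<omega>) \<omega> = a * real_cond_exp MY H g \<omega>"
    by (rule AE_history_cond_exp(2)[OF _ Y.cond_integrable_cmult(2)[OF i(2)]]) measurable
  ultimately have "AE \<omega> in H. real_cond_exp MX H (\<lambda>\<omega>. a * f \<omega>) \<omega>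
      = real_cond_exp MY H (\<lambda>\<omega>. a * g \<omega>) \<omega> + a * c"
    using e by eventually_elim (simp add: distrib_left)
  then show ?thesis
    using X.cond_integrable_cmult(1)[OF i(1)] Y.cond_integrable_cmult(1)[OF i(2)]
    by (simp add: mean_shift_def)
qed

lemma mean_shift_history_measurable:
  assumes [measurable]: "f \<in> borel_measurable H" "g \<in> borel_measurable H"
    and shift: "\<And>\<omega>. \<omega> \<in> space H \<Longrightarrow> f \<omega> = g \<omega> + c"
  shows "mean_shift f g c"
proof -
  have "AE \<omega> in H. real_cond_exp MX H f \<omega> = f \<omega>"
    by (rule AE_history_cond_exp(1)[OF _ X.real_cond_exp_subalg_measurable(2)]) measurable
  moreover have "AE \<omega> in H. real_cond_exp MY H g \<omega> = g \<omega>"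
    by (rule AE_history_cond_exp(2)[OF _ Y.real_cond_exp_subalg_measurable(2)]) measurable
  ultimately have "AE \<omega> in H. real_cond_exp MX H f \<omega> = real_cond_exp MY H g \<omega> + c"
    using AE_space by eventually_elim (simp add: shift)
  then show ?thesis
    by (simp add: mean_shift_def X.real_cond_exp_subalg_measurable(1)
        Y.real_cond_exp_subalg_measurable(1))
qed

lemma mean_shift_cong:
  assumes "mean_shift f g c"
    and "\<And>\<omega>. \<omega> \<in> space MX \<Longrightarrow> f' \<omega> = f \<omega>" "\<And>\<omega>. \<omega> \<in> space MY \<Longrightarrow> g' \<omega> = g \<omega>" "c' = c"
  shows "mean_shift f' g' c'"
proof -
  have i: "cond_integrable MX H f" "cond_integrable MY H g"
    and e: "AE \<omega> in H. real_cond_exp MX H f \<omega> = real_cond_exp MY H g \<omega> + c"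
    using assms(1) by (auto simp: mean_shift_def)
  have meas: "f' \<in> borel_measurable MX \<longleftrightarrow> f \<in> borel_measurable MX"
    "g' \<in> borel_measurable MY \<longleftrightarrow> g \<in> borel_measurable MY"
    by (rule measurable_cong; simp add: assms)+
  then have [measurable]: "f \<in> borel_measurable MX" "g \<in> borel_measurable MY"
    "f' \<in> borel_measurable MX" "g' \<in> borel_measurable MY"
    using i by (auto simp: cond_integrable_def)
  have "cond_integrable MX H f'"
  proof (rule X.cond_integrable_bound)
    show "AE \<omega> in MX. ennreal \<bar>f' \<omega>\<bar> \<le> ennreal \<bar>f \<omega>\<bar>" by (simp add: assms(2))
    show "AE \<omega> in MX. nn_cond_exp MX H (\<lambda>\<omega>. ennreal \<bar>f \<omega>\<bar>) \<omega> < \<infinity>"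
      using i(1) by (simp only: cond_integrable_def)
  qed measurable
  moreover have "cond_integrable MY H g'"
  proof (rule Y.cond_integrable_bound)
    show "AE \<omega> in MY. ennreal \<bar>g' \<omega>\<bar> \<le> ennreal \<bar>g \<omega>\<bar>" by (simp add: assms(3))
    show "AE \<omega> in MY. nn_cond_exp MY H (\<lambda>\<omega>. ennreal \<bar>g \<omega>\<bar>) \<omega> < \<infinity>"
      using i(2) by (simp only: cond_integrable_def)
  qed measurable
  ultimately have i': "cond_integrable MX H f'" "cond_integrable MY H g'" .
  have "AE \<omega> in H. real_cond_exp MX H f' \<omega> = real_cond_exp MX H f \<omega>"
    by (rule AE_history_cond_exp(1)[OF _ X.real_cond_exp_cong]) (auto simp: assms(2))
  moreover have "AE \<omega> in H. real_cond_exp MY H g' \<omega> = real_cond_exp MY H g \<omega>"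
    by (rule AE_history_cond_exp(2)[OF _ Y.real_cond_exp_cong]) (auto simp: assms(3))
  ultimately have "AE \<omega> in H. real_cond_exp MX H f' \<omega> = real_cond_exp MY H g' \<omega> + c'"
    using e by eventually_elim (simp add: assms(4))
  then show ?thesis using i' by (simp add: mean_shift_def)
qed

lemma mean_shift_sum:
  assumes "finite I" "\<And>i. i \<in> I \<Longrightarrow> mean_shift (f i) (g i) (c i)"
  shows "mean_shift (\<lambda>\<omega>. \<Sum>i\<in>I. f i \<omega>) (\<lambda>\<omega>. \<Sum>i\<in>I. g i \<omega>) (\<Sum>i\<in>I. c i)"
  using assms
proof (induction I rule: finite_induct)
  case empty
  show ?case by (simp, rule mean_shift_history_measurable) auto
next
  case (insert i I)
  then have "mean_shift (\<lambda>\<omega>. f i \<omega> + (\<Sum>i\<in>I. f i \<omega>)) (\<lambda>\<omega>. g i \<omega> + (\<Sum>i\<in>I. g i \<omega>)) (c i + (\<Sum>i\<in>I. c i))"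
    by (intro mean_shift_add) auto
  with insert show ?case by simp
qed

text \<open>
For an event \<open>A\<close> of the history, equality of the conditional probabilities says that the law of \<open>U\<close>
weighted by \<open>A\<close> equals that of \<open>V\<close>.  Integrating \<open>f\<close> shows that the two weighted measures
\<open>f(U) dMX\<close> and \<open>f(V) dMY\<close> agree on \<open>H\<close>.  As \<^const>\<open>nn_cond_exp\<close> is the density of such a measure
with respect to the common restriction \<open>H\<close>, the result is an equality of functions, not just an almost
sure one.
\<close>

lemma nn_cond_exp_eq_of_conditional_law:
  fixes f :: "'w \<Rightarrow> ennreal"
  assumes U[measurable]: "U \<in> measurable MX E" and V[measurable]: "V \<in> measurable MY E"
    and [measurable]: "f \<in> borel_measurable E"
    and law: "\<And>B. B \<in> sets E \<Longrightarrow> AE \<omega> in H.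
      real_cond_exp MX H (\<lambda>\<omega>. indicator B (U \<omega>)) \<omega> = real_cond_exp MY H (\<lambda>\<omega>. indicator B (V \<omega>)) \<omega>"
  shows "nn_cond_exp MX H (\<lambda>\<omega>. f (U \<omega>)) = nn_cond_exp MY H (\<lambda>\<omega>. f (V \<omega>))"
proof -
  \<comment> \<open>\<^const>\<open>real_cond_exp\<close> truncates infinite values to 0; an indicator has conditional mean at most 1,
    so nothing is lost.\<close>
  have prob: "AE \<omega> in H. ennreal (real_cond_exp M H (\<lambda>\<omega>. indicator B (Z \<omega>)) \<omega>)
      = nn_cond_exp M H (\<lambda>\<omega>. indicator B (Z \<omega>)) \<omega>"
    if B[measurable]: "B \<in> sets E" and Z[measurable]: "Z \<in> measurable M E"
      and MH: "sigma_finite_subalgebra M H" "restr_to_subalg M H = H" for B M and Z :: "'a \<Rightarrow> 'w"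
  proof -
    interpret sigma_finite_subalgebra M H by fact
    have "AE \<omega> in M. (1::ennreal) = nn_cond_exp M H (\<lambda>_. 1) \<omega>"
      by (rule nn_cond_exp_F_meas) auto
    moreover have "AE \<omega> in M. nn_cond_exp M H (\<lambda>\<omega>. indicator B (Z \<omega>)) \<omega> \<le> nn_cond_exp M H (\<lambda>_. 1) \<omega>"
      by (rule nn_cond_exp_mono) (auto simp: indicator_def)
    moreover have "AE \<omega> in M. (0::ennreal) = nn_cond_exp M H (\<lambda>_. 0) \<omega>"
      by (rule nn_cond_exp_F_meas) auto
    ultimately have *: "AE \<omega> in M. ennreal (real_cond_exp M H (\<lambda>\<omega>. indicator B (Z \<omega>)) \<omega>)
      = nn_cond_exp M H (\<lambda>\<omega>. indicator B (Z \<omega>)) \<omega>"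
    proof eventually_elim
      case (elim \<omega>)
      have "(\<lambda>\<omega>. ennreal (- indicator B (Z \<omega>))) = (\<lambda>_. 0)"
        by (auto simp: fun_eq_iff indicator_def ennreal_neg)
      moreover have "nn_cond_exp M H (\<lambda>\<omega>. indicator B (Z \<omega>)) \<omega> < top"
        using elim(2) unfolding elim(1)[symmetric] by (rule le_less_trans) simp
      ultimately show ?case
        using elim(3)[symmetric] by (simp add: real_cond_exp_def ennreal_indicator)
    qed
    show ?thesis
      using AE_restr_to_subalg2[OF subalg *] unfolding MH(2) by measurable
  qed
  have same: "AE \<omega> in H. nn_cond_exp MX H (\<lambda>\<omega>. indicator B (U \<omega>)) \<omega>
      = nn_cond_exp MY H (\<lambda>\<omega>. indicator B (V \<omega>)) \<omega>" if B: "B \<in> sets E" for B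
    using law[OF B] prob[OF B U X.sigma_finite_subalgebra_axioms restr_X]
      prob[OF B V Y.sigma_finite_subalgebra_axioms restr_Y]
    by eventually_elim simp
  have HX: "A \<in> sets MX" and HY: "A \<in> sets MY" if "A \<in> sets H" for A
    using that X.subalg Y.subalg by (auto simp: subalgebra_def)
  \<comment> \<open>Equality of the weighted laws on \<open>E\<close> upgrades from events \<open>B\<close> to all nonnegative functions at once.\<close>
  have distr: "distr (density MX (indicator A)) E U = distr (density MY (indicator A)) E V"
    if A[measurable]: "A \<in> sets H" for A
  proof (rule measure_eqI)
    fix B assume "B \<in> sets (distr (density MX (indicator A)) E U)"
    then have B[measurable]: "B \<in> sets E" by simp
    have [measurable]: "A \<in> sets MX" "A \<in> sets MY" using HX HY A by auto
    have mass: "emeasure (distr (density M (indicator A)) E Z) B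
        = (\<integral>\<^sup>+\<omega>. indicator A \<omega> * nn_cond_exp M H (\<lambda>\<omega>. indicator B (Z \<omega>)) \<omega> \<partial>H)"
      if Z[measurable]: "Z \<in> measurable M E" and MH: "sigma_finite_subalgebra M H" "restr_to_subalg M H = H"
      for M and Z :: "'a \<Rightarrow> 'w"
    proof -
      interpret sigma_finite_subalgebra M H by fact
      have [measurable]: "A \<in> sets M" using A subalg by (auto simp: subalgebra_def)
      have "emeasure (distr (density M (indicator A)) E Z) B
          = (\<integral>\<^sup>+\<omega>. indicator A \<omega> * indicator (Z -` B \<inter> space M) \<omega> \<partial>M)"
        by (simp add: emeasure_distr emeasure_density)
      also have "\<dots> = (\<integral>\<^sup>+\<omega>. indicator A \<omega> * indicator B (Z \<omega>) \<partial>M)"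
        by (rule nn_integral_cong) (auto simp: indicator_def)
      also have "\<dots> = (\<integral>\<^sup>+\<omega>. indicator A \<omega> * nn_cond_exp M H (\<lambda>\<omega>. indicator B (Z \<omega>)) \<omega> \<partial>M)"
        by (rule nn_cond_exp_intg[symmetric]) measurable
      also have "\<dots> = (\<integral>\<^sup>+\<omega>. indicator A \<omega> * nn_cond_exp M H (\<lambda>\<omega>. indicator B (Z \<omega>)) \<omega>
          \<partial>restr_to_subalg M H)"
        by (rule nn_integral_subalgebra2[OF subalg, symmetric]) measurable
      finally show ?thesis unfolding MH(2) .
    qed
    show "emeasure (distr (density MX (indicator A)) E U) B
        = emeasure (distr (density MY (indicator A)) E V) B"
      unfolding mass[OF U X.sigma_finite_subalgebra_axioms restr_X]
        mass[OF V Y.sigma_finite_subalgebra_axioms restr_Y]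
      by (rule nn_integral_cong_AE) (use same[OF B] in \<open>auto elim!: eventually_mono\<close>)
  qed simp
  have "restr_to_subalg (density MX (\<lambda>\<omega>. f (U \<omega>))) H = restr_to_subalg (density MY (\<lambda>\<omega>. f (V \<omega>))) H"
  proof (rule measure_eqI)
    have sub: "subalgebra (density MX (\<lambda>\<omega>. f (U \<omega>))) H" "subalgebra (density MY (\<lambda>\<omega>. f (V \<omega>))) H"
      using X.subalg Y.subalg by (auto simp: subalgebra_def)
    then show "sets (restr_to_subalg (density MX (\<lambda>\<omega>. f (U \<omega>))) H)
        = sets (restr_to_subalg (density MY (\<lambda>\<omega>. f (V \<omega>))) H)"
      by (simp add: sets_restr_to_subalg)
    fix A assume "A \<in> sets (restr_to_subalg (density MX (\<lambda>\<omega>. f (U \<omega>))) H)"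
    then have A: "A \<in> sets H" using sub by (simp add: sets_restr_to_subalg)
    have [measurable]: "A \<in> sets MX" "A \<in> sets MY" using HX HY A by auto
    have "emeasure (density MX (\<lambda>\<omega>. f (U \<omega>))) A = (\<integral>\<^sup>+w. f w \<partial>distr (density MX (indicator A)) E U)"
      by (simp add: emeasure_density nn_integral_distr nn_integral_density mult.commute)
    also have "\<dots> = (\<integral>\<^sup>+w. f w \<partial>distr (density MY (indicator A)) E V)"
      by (simp only: distr[OF A])
    also have "\<dots> = emeasure (density MY (\<lambda>\<omega>. f (V \<omega>))) A"
      by (simp add: emeasure_density nn_integral_distr nn_integral_density mult.commute)
    finally show "emeasure (restr_to_subalg (density MX (\<lambda>\<omega>. f (U \<omega>))) H) A
        = emeasure (restr_to_subalg (density MY (\<lambda>\<omega>. f (V \<omega>))) H) A"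
      using sub A by (simp add: emeasure_restr_to_subalg)
  qed
  then show ?thesis
    using X.subalg Y.subalg by (simp add: nn_cond_exp_def restr_X restr_Y)
qed

lemma real_cond_exp_eq_of_conditional_law:
  fixes f :: "'w \<Rightarrow> real"
  assumes [measurable]: "U \<in> measurable MX E" "V \<in> measurable MY E" "f \<in> borel_measurable E"
    and law: "\<And>B. B \<in> sets E \<Longrightarrow> AE \<omega> in H.
      real_cond_exp MX H (\<lambda>\<omega>. indicator B (U \<omega>)) \<omega> = real_cond_exp MY H (\<lambda>\<omega>. indicator B (V \<omega>)) \<omega>"
  shows "real_cond_exp MX H (\<lambda>\<omega>. f (U \<omega>)) = real_cond_exp MY H (\<lambda>\<omega>. f (V \<omega>))"
  unfolding real_cond_exp_def
  using nn_cond_exp_eq_of_conditional_law[OF assms(1,2) _ law, of "\<lambda>w. ennreal (f w)"]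
    nn_cond_exp_eq_of_conditional_law[OF assms(1,2) _ law, of "\<lambda>w. ennreal (- f w)"]
  by simp

end

lemma pos_def_trace_pos: "pos_def (A :: real^'n^'n) \<Longrightarrow> 0 < trace A"
proof -
  assume A: "pos_def A"
  have "0 < A $ i $ i" for i
  proof -
    have "axis i (1::real) \<noteq> 0" by (simp add: axis_eq_0_iff)
    then have "0 < axis i (1::real) \<bullet> (A *v axis i 1)" using A unfolding pos_def_def by blast
    then show ?thesis by (simp add: inner_axis' matrix_vector_mul_component inner_axis)
  qed
  then show ?thesis unfolding trace_def by (intro sum_pos) auto
qed

section \<open>Level response, and variance response in the inert regime\<close>

lemma continuation_modelD:
  assumes "continuation_model dt t0 Hist X"
  shows "prob_space (law X)" and "filtration (space (law X)) (info X)"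
    and "subalgebra (law X) (info X t)"
    and "subalgebra (info X t0) Hist" and "restr_to_subalg (law X) Hist = Hist"
    and "t0 \<le> t \<Longrightarrow> steer X t \<in> borel_measurable (info X (t - 1))"
    and "t0 \<le> t \<Longrightarrow> cond_centered (law X) (info X (t - 1)) (innov X t)"
    and "t0 \<le> t \<Longrightarrow> \<omega> \<in> space (law X) \<Longrightarrow> disp X (Suc t) \<omega> = disp X t \<omega> + dt *\<^sub>R vel X t \<omega>"
    and "t0 \<le> t \<Longrightarrow> \<omega> \<in> space (law X) \<Longrightarrow>
      vel X (Suc t) \<omega> = vel X t \<omega> + (steer X (Suc t) \<omega> + innov X (Suc t) \<omega>)"
    and "t0 < t \<Longrightarrow> AE \<omega> in Hist. nn_cond_exp (law X) Hist
      (\<lambda>\<omega>. ennreal (norm (steer X t \<omega>) + norm (innov X t \<omega>))) \<omega> < \<infinity>"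
  using assms unfolding continuation_model_def by blast+

lemma impulse_comparisonD:
  assumes "impulse_comparison dt t0 Hist p X Y"
  shows "continuation_model dt t0 Hist X" and "continuation_model dt t0 Hist Y"
    and "disp Y t0 \<in> borel_measurable Hist" and "vel Y t0 \<in> borel_measurable Hist"
    and "\<omega> \<in> space Hist \<Longrightarrow> disp X t0 \<omega> = disp Y t0 \<omega>"
    and "\<omega> \<in> space Hist \<Longrightarrow> vel X t0 \<omega> = vel Y t0 \<omega> + p"
    and "t0 < j \<Longrightarrow> AE \<omega> in Hist.
          vec_cond_exp (law X) Hist (steer X j) \<omega> = vec_cond_exp (law Y) Hist (steer Y j) \<omega>"
  using assms unfolding impulse_comparison_def by blast+

lemma continuation_model_subalgebras:
  assumes "continuation_model dt t0 Hist X"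
  shows "sigma_finite_subalgebra (law X) (info X t)" "sigma_finite_subalgebra (law X) Hist"
    and "t0 \<le> t \<Longrightarrow> subalgebra (info X t) Hist"
    and "restr_to_subalg (law X) Hist = Hist" "space (law X) = space Hist"
proof -
  note filt = continuation_modelD(2)[OF assms] and sub = continuation_modelD(3)[OF assms]
    and H = continuation_modelD(4)[OF assms]
  interpret prob_space "law X" by (rule continuation_modelD(1)[OF assms])
  have fin: "sigma_finite_subalgebra (law X) F" if "subalgebra (law X) F" for F
    by (rule finite_measure_subalgebra_is_sigma_finite, unfold_locales) (rule that)
  show "sigma_finite_subalgebra (law X) (info X t)" by (rule fin[OF sub])
  have later: "subalgebra (info X t) Hist" if "t0 \<le> t" for t
    using H sub[of t] sub[of t0] filtration.sets_F_mono[OF filt that]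
    by (auto simp: subalgebra_def)
  then show "t0 \<le> t \<Longrightarrow> subalgebra (info X t) Hist" .
  have "subalgebra (law X) Hist"
    using later[of t0] sub[of t0] by (auto simp: subalgebra_def)
  then show "sigma_finite_subalgebra (law X) Hist" "space (law X) = space Hist"
    using fin by (auto simp: subalgebra_def)
  show "restr_to_subalg (law X) Hist = Hist" by (rule continuation_modelD(5)[OF assms])
qed

lemma continuation_common_history:
  assumes "continuation_model dt t0 Hist X" "continuation_model dt t0 Hist Y"
  shows "common_history (law X) (law Y) Hist"
  using continuation_model_subalgebras(2,4)[OF assms(1)] continuation_model_subalgebras(2,4)[OF assms(2)]
  by (simp add: common_history_def common_history_axioms_def)

text \<open>
For \<open>j > t0\<close> the information at \<open>j - 1\<close> contains the history, so centering given that
information implies centering given the history.  At \<open>j = t0\<close> this containment may fail, but the innovation of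
step \<open>t0\<close> is already part of the state from which the response starts.
\<close>

lemma future_increments:
  assumes model: "continuation_model dt t0 Hist X" and j: "t0 < j"
  shows "cond_integrable (law X) Hist (\<lambda>\<omega>. steer X j \<omega> $ i)"
    and "cond_integrable (law X) Hist (\<lambda>\<omega>. innov X j \<omega> $ i)"
    and "AE \<omega> in law X. real_cond_exp (law X) Hist (\<lambda>\<omega>. innov X j \<omega> $ i) \<omega> = 0"
proof -
  note sub = continuation_model_subalgebras[OF model]
  interpret H: sigma_finite_subalgebra "law X" Hist by (rule sub(2))
  interpret P: sigma_finite_subalgebra "law X" "info X (j - 1)" by (rule sub(1))
  note centered = continuation_modelD(7)[OF model less_imp_le[OF j]]
    and steer = continuation_modelD(6)[OF model less_imp_le[OF j]]
    and fin = continuation_modelD(10)[OF model j]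
  have [measurable]: "steer X j \<in> borel_measurable (law X)" "innov X j \<in> borel_measurable (law X)"
    using measurable_from_subalg[OF P.subalg steer] centered by (auto simp: cond_centered_def)
  have fin': "AE \<omega> in law X. nn_cond_exp (law X) Hist
            (\<lambda>\<omega>. ennreal (norm (steer X j \<omega>) + norm (innov X j \<omega>))) \<omega> < \<infinity>"
    by (rule AE_restr_to_subalg[OF H.subalg]) (simp only: sub(4) fin)
  have bound: "\<bar>steer X j \<omega> $ i\<bar> \<le> norm (steer X j \<omega>) + norm (innov X j \<omega>)"
    "\<bar>innov X j \<omega> $ i\<bar> \<le> norm (steer X j \<omega>) + norm (innov X j \<omega>)" for \<omega>
    using component_le_norm_cart[of "steer X j \<omega>" i] component_le_norm_cart[of "innov X j \<omega>" i]
    by (simp_all add: add_increasing add_increasing2)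
  show "cond_integrable (law X) Hist (\<lambda>\<omega>. steer X j \<omega> $ i)"
    by (rule H.cond_integrable_bound[OF _ _ _ fin']) (measurable, intro AE_I2 ennreal_leI bound)
  show "cond_integrable (law X) Hist (\<lambda>\<omega>. innov X j \<omega> $ i)"
    by (rule H.cond_integrable_bound[OF _ _ _ fin']) (measurable, intro AE_I2 ennreal_leI bound)
  have "t0 \<le> j - 1" using j by simp
  then show "AE \<omega> in law X. real_cond_exp (law X) Hist (\<lambda>\<omega>. innov X j \<omega> $ i) \<omega> = 0"
    by (intro H.real_cond_exp_zero_tower[OF P.subalg] sub(3) P.cond_centered_components[OF centered])
qed

text \<open>
The velocity difference is conserved in the mean because steering and innovation shift the means by 0;
the displacement then picks up \<open>dt\<close> times this difference at each step.  Both claims are proved in one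
induction.
\<close>

lemma impulse_mean_shift:
  assumes comp: "impulse_comparison dt t0 Hist p X Y"
  shows "common_history.mean_shift (law X) (law Y) Hist
        (\<lambda>\<omega>. disp X (t0 + h) \<omega> $ i) (\<lambda>\<omega>. disp Y (t0 + h) \<omega> $ i) (real h * dt * p $ i)
      \<and> common_history.mean_shift (law X) (law Y) Hist
        (\<lambda>\<omega>. vel X (t0 + h) \<omega> $ i) (\<lambda>\<omega>. vel Y (t0 + h) \<omega> $ i) (p $ i)"
proof -
  note mX = impulse_comparisonD(1)[OF comp] and mY = impulse_comparisonD(2)[OF comp]
  interpret common_history "law X" "law Y" Hist by (rule continuation_common_history[OF mX mY])
  show ?thesis
  proof (induction h)
    case 0
    note init = impulse_comparisonD(5,6)[OF comp]
    note [measurable] = impulse_comparisonD(3,4)[OF comp]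
    have "disp X t0 \<in> borel_measurable Hist \<longleftrightarrow> disp Y t0 \<in> borel_measurable Hist"
      "vel X t0 \<in> borel_measurable Hist \<longleftrightarrow> (\<lambda>\<omega>. vel Y t0 \<omega> + p) \<in> borel_measurable Hist"
      by (rule measurable_cong; simp add: init)+
    then have [measurable]: "disp X t0 \<in> borel_measurable Hist" "vel X t0 \<in> borel_measurable Hist"
      by simp_all
    show ?case
      by (intro conjI mean_shift_history_measurable) (auto simp: init)
  next
    case (Suc h)
    let ?j = "Suc (t0 + h)"
    have j: "t0 < ?j" by simp
    have steer: "mean_shift (\<lambda>\<omega>. steer X ?j \<omega> $ i) (\<lambda>\<omega>. steer Y ?j \<omega> $ i) 0"
      using impulse_comparisonD(7)[OF comp j] unfolding mean_shift_def
      by (auto simp: future_increments[OF mX j] future_increments[OF mY j]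
          vec_cond_exp_def vec_eq_iff elim!: eventually_mono)
    have "AE \<omega> in Hist. real_cond_exp (law X) Hist (\<lambda>\<omega>. innov X ?j \<omega> $ i) \<omega> = 0"
      "AE \<omega> in Hist. real_cond_exp (law Y) Hist (\<lambda>\<omega>. innov Y ?j \<omega> $ i) \<omega> = 0"
      using AE_history_cond_exp(1)[OF _ future_increments(3)[OF mX j]]
        AE_history_cond_exp(2)[OF _ future_increments(3)[OF mY j]] by auto
    then have "AE \<omega> in Hist. real_cond_exp (law X) Hist (\<lambda>\<omega>. innov X ?j \<omega> $ i) \<omega>
        = real_cond_exp (law Y) Hist (\<lambda>\<omega>. innov Y ?j \<omega> $ i) \<omega> + 0"
      by eventually_elim simp
    then have innov: "mean_shift (\<lambda>\<omega>. innov X ?j \<omega> $ i) (\<lambda>\<omega>. innov Y ?j \<omega> $ i) 0"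
      unfolding mean_shift_def by (simp add: future_increments[OF mX j] future_increments[OF mY j])
    show ?case
    proof
      show "mean_shift (\<lambda>\<omega>. disp X (t0 + Suc h) \<omega> $ i) (\<lambda>\<omega>. disp Y (t0 + Suc h) \<omega> $ i)
          (real (Suc h) * dt * p $ i)"
        by (rule mean_shift_cong[OF mean_shift_add[OF conjunct1[OF Suc] mean_shift_cmult[OF conjunct2[OF Suc], of dt]]])
          (auto simp: continuation_modelD(8,9)[OF mX] continuation_modelD(8,9)[OF mY] algebra_simps)
      show "mean_shift (\<lambda>\<omega>. vel X (t0 + Suc h) \<omega> $ i) (\<lambda>\<omega>. vel Y (t0 + Suc h) \<omega> $ i) (p $ i)"
        by (rule mean_shift_cong[OF mean_shift_add[OF conjunct2[OF Suc] mean_shift_add[OF steer innov]]])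
          (auto simp: continuation_modelD(8,9)[OF mX] continuation_modelD(8,9)[OF mY])
    qed
  qed
qed

lemma level_response_impulse:
  assumes comp: "impulse_comparison dt t0 Hist p X Y"
  shows "AE \<omega> in Hist. \<forall>h. level_response t0 Hist d X Y h \<omega> = real h * dt * (p \<bullet> (d /\<^sub>R norm d))"
proof -
  note mX = impulse_comparisonD(1)[OF comp] and mY = impulse_comparisonD(2)[OF comp]
  interpret common_history "law X" "law Y" Hist by (rule continuation_common_history[OF mX mY])
  let ?u = "d /\<^sub>R norm d"
  have "AE \<omega> in Hist. level_response t0 Hist d X Y h \<omega> = real h * dt * (p \<bullet> ?u)" for h
  proof -
    have "mean_shift (\<lambda>\<omega>. \<Sum>i\<in>UNIV. ?u $ i * disp X (t0 + h) \<omega> $ i)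
        (\<lambda>\<omega>. \<Sum>i\<in>UNIV. ?u $ i * disp Y (t0 + h) \<omega> $ i) (\<Sum>i\<in>UNIV. ?u $ i * (real h * dt * p $ i))"
      by (intro mean_shift_sum mean_shift_cmult conjunct1[OF impulse_mean_shift[OF comp]]) auto
    then have "mean_shift (\<lambda>\<omega>. disp X (t0 + h) \<omega> \<bullet> ?u) (\<lambda>\<omega>. disp Y (t0 + h) \<omega> \<bullet> ?u)
        (real h * dt * (p \<bullet> ?u))"
      by (rule mean_shift_cong) (simp_all add: inner_vec_def sum_distrib_left ac_simps)
    then have "AE \<omega> in Hist. real_cond_exp (law X) Hist (\<lambda>\<omega>. disp X (t0 + h) \<omega> \<bullet> ?u) \<omega>
        = real_cond_exp (law Y) Hist (\<lambda>\<omega>. disp Y (t0 + h) \<omega> \<bullet> ?u) \<omega> + real h * dt * (p \<bullet> ?u)"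
      by (simp add: mean_shift_def)
    then show ?thesis by eventually_elim (simp add: level_response_def)
  qed
  then show ?thesis by (simp add: AE_all_countable)
qed

text \<open>
The form used for both regimes, with \<open>c = 1\<close> in the inert and \<open>c = \<eta>\<close> in the stabilized one.
\<close>

lemma level_response_along_impulse:
  assumes "impulse_comparison dt t0 Hist (c *\<^sub>R d) X Y"
  shows "AE \<omega> in Hist. \<forall>h. level_response t0 Hist d X Y h \<omega> = c * norm d * real h * dt"
proof -
  have "real h * dt * ((c *\<^sub>R d) \<bullet> (d /\<^sub>R norm d)) = c * norm d * real h * dt" for h
    by (cases "d = 0") (simp_all add: dot_square_norm power2_eq_square)
  with level_response_impulse[OF assms, of d] show ?thesis by (simp only:)
qed

lemma inert_regimeD:
  assumes "inert_regime t0 Hist C E G X W"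
  shows "G \<in> borel_measurable E" and "W (t0 + h) \<in> measurable (info X (t0 + h - 1)) E"
    and "AE \<omega> in law X. innov_cov X (t0 + h) \<omega> = C + G (W (t0 + h) \<omega>)"
  using assms unfolding inert_regime_def by (blast intro: le_add1)+

lemma trace_innov_cov_measurable: "(\<lambda>\<omega>. trace (innov_cov X t \<omega>)) \<in> borel_measurable (law X)"
  by (simp add: trace_def innov_cov_def cond_cov_def)

text \<open>
Almost surely the trace of the covariance is \<open>trace (C + G (W))\<close>, a fixed function of the
environment, whose conditional law is the same in both continuations.
\<close>

lemma inert_variance_response:
  assumes comp: "inert_comparison dt t0 Hist C E G d X WX Y WY"
  shows "AE \<omega> in Hist. \<forall>h. variance_response t0 Hist X Y h \<omega> = 0"
proof -
  have imp: "impulse_comparison dt t0 Hist d X Y" and rX: "inert_regime t0 Hist C E G X WX"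
    and rY: "inert_regime t0 Hist C E G Y WY" and env: "same_environment_law t0 Hist E X WX Y WY"
    using comp by (simp_all only: inert_comparison_def)
  note mX = impulse_comparisonD(1)[OF imp] and mY = impulse_comparisonD(2)[OF imp]
  interpret common_history "law X" "law Y" Hist by (rule continuation_common_history[OF mX mY])
  have [measurable]: "G \<in> borel_measurable E" by (rule inert_regimeD(1)[OF rX])
  have "AE \<omega> in Hist. variance_response t0 Hist X Y h \<omega> = 0" for h
  proof -
    have W_meas: "W (t0 + k) \<in> measurable (law Z) E"
      if "continuation_model dt t0 Hist Z" "inert_regime t0 Hist C E G Z W" for Z and W k
      by (rule measurable_from_subalg[OF continuation_modelD(3)[OF that(1)] inert_regimeD(2)[OF that(2)]])
    note [measurable] = W_meas[OF mX rX] W_meas[OF mY rY]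
    let ?g = "\<lambda>w. trace (C + G w)"
    have [measurable]: "?g \<in> borel_measurable E" unfolding trace_def vector_add_component by measurable
    have reduce: "AE \<omega> in law Z. real_cond_exp (law Z) Hist (\<lambda>\<omega>. trace (innov_cov Z (t0 + h) \<omega>)) \<omega>
        = real_cond_exp (law Z) Hist (\<lambda>\<omega>. ?g (W (t0 + h) \<omega>)) \<omega>"
      if Z: "continuation_model dt t0 Hist Z" "inert_regime t0 Hist C E G Z W" for Z and W
    proof (rule sigma_finite_subalgebra.real_cond_exp_cong[OF continuation_model_subalgebras(2)[OF Z(1)]])
      have "AE \<omega> in law Z. innov_cov Z (t0 + h) \<omega> = C + G (W (t0 + h) \<omega>)"
        by (rule inert_regimeD(3)[OF Z(2)])
      then show "AE \<omega> in law Z. trace (innov_cov Z (t0 + h) \<omega>) = ?g (W (t0 + h) \<omega>)"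
        by eventually_elim simp
      note [measurable] = W_meas[OF Z]
      show "(\<lambda>\<omega>. trace (innov_cov Z (t0 + h) \<omega>)) \<in> borel_measurable (law Z)"
        by (rule trace_innov_cov_measurable)
      show "(\<lambda>\<omega>. ?g (W (t0 + h) \<omega>)) \<in> borel_measurable (law Z)" by measurable
    qed
    have "AE \<omega> in Hist. real_cond_exp (law X) Hist (\<lambda>\<omega>. indicator B (WX (t0 + h) \<omega>)) \<omega>
        = real_cond_exp (law Y) Hist (\<lambda>\<omega>. indicator B (WY (t0 + h) \<omega>)) \<omega>" if B[measurable]: "B \<in> sets E" for B
    proof -
      \<comment> \<open>The hypothesis concerns whole environment paths; the cylinder set over coordinate \<open>h\<close> extracts
        the law at a single time.\<close>
      let ?P = "PiM (UNIV :: nat set) (\<lambda>_. E)"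
      let ?A = "{w \<in> space ?P. w h \<in> B}"
      have "?A \<in> sets ?P" by measurable
      with env have eq: "AE \<omega> in Hist.
          real_cond_exp (law X) Hist (\<lambda>\<omega>. indicator ?A (\<lambda>h. WX (t0 + h) \<omega>)) \<omega>
          = real_cond_exp (law Y) Hist (\<lambda>\<omega>. indicator ?A (\<lambda>h. WY (t0 + h) \<omega>)) \<omega>"
        unfolding same_environment_law_def by blast
      have path: "AE \<omega> in law Z. real_cond_exp (law Z) Hist (\<lambda>\<omega>. indicator ?A (\<lambda>h. W (t0 + h) \<omega>)) \<omega>
          = real_cond_exp (law Z) Hist (\<lambda>\<omega>. indicator B (W (t0 + h) \<omega>)) \<omega>"
        if Z: "continuation_model dt t0 Hist Z" "inert_regime t0 Hist C E G Z W" for Z and W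
      proof (rule sigma_finite_subalgebra.real_cond_exp_cong[OF continuation_model_subalgebras(2)[OF Z(1)]])
        note [measurable] = W_meas[OF Z]
        have same: "indicator ?A (\<lambda>h. W (t0 + h) \<omega>) = (indicator B (W (t0 + h) \<omega>) :: real)"
          if "\<omega> \<in> space (law Z)" for \<omega>
          using measurable_space[OF W_meas[OF Z] that] by (auto simp: indicator_def space_PiM)
        then show "AE \<omega> in law Z. indicator ?A (\<lambda>h. W (t0 + h) \<omega>) = (indicator B (W (t0 + h) \<omega>) :: real)"
          by (intro AE_I2)
        show B': "(\<lambda>\<omega>. indicator B (W (t0 + h) \<omega>) :: real) \<in> borel_measurable (law Z)" by measurable
        show "(\<lambda>\<omega>. indicator ?A (\<lambda>h. W (t0 + h) \<omega>) :: real) \<in> borel_measurable (law Z)"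
          by (subst measurable_cong[OF same]) (use B' in auto)
      qed
      show ?thesis
        using eq AE_history_cond_exp(1)[OF _ path[OF mX rX]] AE_history_cond_exp(2)[OF _ path[OF mY rY]]
        by (auto elim: eventually_elim2)
    qed
    then have "real_cond_exp (law X) Hist (\<lambda>\<omega>. ?g (WX (t0 + h) \<omega>))
        = real_cond_exp (law Y) Hist (\<lambda>\<omega>. ?g (WY (t0 + h) \<omega>))"
      by (intro real_cond_exp_eq_of_conditional_law[of _ E]) auto
    then have "AE \<omega> in Hist. real_cond_exp (law X) Hist (\<lambda>\<omega>. ?g (WX (t0 + h) \<omega>)) \<omega>
        = real_cond_exp (law Y) Hist (\<lambda>\<omega>. ?g (WY (t0 + h) \<omega>)) \<omega>" by simp
    moreover have "AE \<omega> in Hist. real_cond_exp (law X) Hist (\<lambda>\<omega>. trace (innov_cov X (t0 + h) \<omega>)) \<omega>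
        = real_cond_exp (law X) Hist (\<lambda>\<omega>. ?g (WX (t0 + h) \<omega>)) \<omega>"
      by (rule AE_history_cond_exp(1)[OF _ reduce[OF mX rX]]) simp
    moreover have "AE \<omega> in Hist. real_cond_exp (law Y) Hist (\<lambda>\<omega>. trace (innov_cov Y (t0 + h) \<omega>)) \<omega>
        = real_cond_exp (law Y) Hist (\<lambda>\<omega>. ?g (WY (t0 + h) \<omega>)) \<omega>"
      by (rule AE_history_cond_exp(2)[OF _ reduce[OF mY rY]]) simp
    ultimately show ?thesis by eventually_elim (simp add: variance_response_def)
  qed
  then show ?thesis by (simp add: AE_all_countable)
qed

section \<open>The stabilized regime\<close>

lemma stabilized_regimeD:
  assumes "stabilized_regime t0 Hist lam \<Sigma> X K \<zeta> \<nu>"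
  shows "pos_def \<Sigma>" and "K h \<in> borel_measurable Hist"
    and "cond_centered (law X) (info X (t0 + h - 1)) (\<zeta> (t0 + h))"
    and "cond_centered (law X) (info X (t0 + h - 1)) (\<nu> (t0 + h))"
    and "AE \<omega> in law X. cond_cov (law X) (info X (t0 + h - 1))
          (\<lambda>\<omega>. (1 - lam) *\<^sub>R \<zeta> (t0 + h) \<omega> + lam *\<^sub>R \<nu> (t0 + h) \<omega>) \<omega> = \<Sigma>"
    and "\<omega> \<in> space (law X) \<Longrightarrow> innov X (t0 + h) \<omega> =
          (1 - K h \<omega>) *\<^sub>R ((1 - lam) *\<^sub>R \<zeta> (t0 + h) \<omega> + lam *\<^sub>R \<nu> (t0 + h) \<omega>)"
  using assms unfolding stabilized_regime_def by (blast intro: le_add1)+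

text \<open>
The factor \<open>1 - K h\<close> is known given the preceding information and leaves the covariance as its
square.  For \<open>h > 0\<close> it is known because that information contains the history.  For \<open>h = 0\<close> the
preceding information is that of step \<open>t0 - 1\<close>, which need not contain the history; a gain
that is constant at onset is measurable there all the same, and this covers both an episode starting
at 0 and a constant gain.
\<close>

lemma stabilized_innov_cov:
  assumes model: "continuation_model dt t0 Hist X"
    and regime: "stabilized_regime t0 Hist lam \<Sigma> X K \<zeta> \<nu>"
    and onset: "\<forall>\<omega>\<in>space Hist. K 0 \<omega> = k0"
  shows "AE \<omega> in law X. innov_cov X (t0 + h) \<omega> = (1 - K h \<omega>)\<^sup>2 *\<^sub>R \<Sigma>"
proof -
  note sub = continuation_model_subalgebras[OF model] and regimeD = stabilized_regimeD[OF regime]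
  let ?F = "info X (t0 + h - 1)"
  let ?r = "\<lambda>\<omega>. (1 - lam) *\<^sub>R \<zeta> (t0 + h) \<omega> + lam *\<^sub>R \<nu> (t0 + h) \<omega>"
  interpret sigma_finite_subalgebra "law X" ?F by (rule sub(1))
  have K[measurable]: "K h \<in> borel_measurable ?F"
  proof (cases "h = 0")
    case True
    have "space ?F = space Hist" using subalg sub(5) by (auto simp: subalgebra_def)
    then have "K h \<in> borel_measurable ?F \<longleftrightarrow> (\<lambda>_. k0) \<in> borel_measurable ?F"
      by (intro measurable_cong) (simp add: True onset)
    then show ?thesis by simp
  next
    case False
    then show ?thesis
      by (intro measurable_from_subalg[OF sub(3) regimeD(2)]) simp
  qed
  have centered: "cond_centered (law X) ?F (innov X (t0 + h))"
    by (rule continuation_modelD(7)[OF model]) simp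
  then have [measurable]: "innov X (t0 + h) \<in> borel_measurable (law X)"
    by (simp add: cond_centered_def)
  have [measurable]: "\<zeta> (t0 + h) \<in> borel_measurable (law X)" "\<nu> (t0 + h) \<in> borel_measurable (law X)"
    using regimeD(3,4) by (auto simp: cond_centered_def)
  have "AE \<omega> in law X. real_cond_exp (law X) ?F (\<lambda>\<omega>. ?r \<omega> $ i) \<omega> = 0" for i
  proof -
    note \<zeta> = cond_centered_components[OF regimeD(3)[of h], of i]
      and \<nu> = cond_centered_components[OF regimeD(4)[of h], of i]
    have "AE \<omega> in law X. real_cond_exp (law X) ?F
        (\<lambda>\<omega>. (1 - lam) * \<zeta> (t0 + h) \<omega> $ i + lam * \<nu> (t0 + h) \<omega> $ i) \<omega>
      = real_cond_exp (law X) ?F (\<lambda>\<omega>. (1 - lam) * \<zeta> (t0 + h) \<omega> $ i) \<omega>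
        + real_cond_exp (law X) ?F (\<lambda>\<omega>. lam * \<nu> (t0 + h) \<omega> $ i) \<omega>"
      by (rule cond_integrable_add(2)[OF cond_integrable_cmult(1)[OF \<zeta>(1)] cond_integrable_cmult(1)[OF \<nu>(1)]])
    with cond_integrable_cmult(2)[OF \<zeta>(1), of "1 - lam"] cond_integrable_cmult(2)[OF \<nu>(1), of lam] \<zeta>(2) \<nu>(2)
    have "AE \<omega> in law X. real_cond_exp (law X) ?F
        (\<lambda>\<omega>. (1 - lam) * \<zeta> (t0 + h) \<omega> $ i + lam * \<nu> (t0 + h) \<omega> $ i) \<omega> = 0"
      by eventually_elim simp
    then show ?thesis by simp
  qed
  then have "AE \<omega> in law X. \<forall>i. real_cond_exp (law X) ?F (\<lambda>\<omega>. ?r \<omega> $ i) \<omega> = 0"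
    unfolding AE_all_countable by (rule allI)
  then have zero: "AE \<omega> in law X. vec_cond_exp (law X) ?F ?r \<omega> = 0"
    by eventually_elim (simp only: vec_cond_exp_def vec_eq_iff vec_lambda_beta zero_index simp_thms)
  have "AE \<omega> in law X. cond_cov (law X) ?F (innov X (t0 + h)) \<omega> = (1 - K h \<omega>)\<^sup>2 *\<^sub>R cond_cov (law X) ?F ?r \<omega>"
  proof (rule cond_cov_scale)
    show "AE \<omega> in law X. vec_cond_exp (law X) ?F (innov X (t0 + h)) \<omega> = 0"
      using centered by (simp add: cond_centered_def)
    show "(\<lambda>\<omega>. 1 - K h \<omega>) \<in> borel_measurable ?F" by measurable
  qed (use regimeD(6) zero in simp_all)
  with regimeD(5)[of h] show ?thesis
    by eventually_elim (simp add: innov_cov_def)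
qed

text \<open>
The covariances are functions of the history, so conditioning on the history does not change
them.  Admitting gains in both continuations covers the reaction-gain episode and the comparison with
equal constant gains.
\<close>

lemma stabilized_variance_response:
  assumes comp: "stabilized_comparison dt t0 Hist \<eta> lam \<Sigma> d X KX \<zeta>X \<nu>X Y KY \<zeta>Y \<nu>Y"
    and onset: "\<forall>\<omega>\<in>space Hist. KX 0 \<omega> = kX" "\<forall>\<omega>\<in>space Hist. KY 0 \<omega> = kY"
  shows "AE \<omega> in Hist. \<forall>h. variance_response t0 Hist X Y h \<omega>
      = ((1 - KX h \<omega>)\<^sup>2 - (1 - KY h \<omega>)\<^sup>2) * trace \<Sigma>"
proof -
  have imp: "impulse_comparison dt t0 Hist (\<eta> *\<^sub>R d) X Y"
    and rX: "stabilized_regime t0 Hist lam \<Sigma> X KX \<zeta>X \<nu>X" and rY: "stabilized_regime t0 Hist lam \<Sigma> Y KY \<zeta>Y \<nu>Y"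
    using comp unfolding stabilized_comparison_def by blast+
  note mX = impulse_comparisonD(1)[OF imp] and mY = impulse_comparisonD(2)[OF imp]
  interpret common_history "law X" "law Y" Hist by (rule continuation_common_history[OF mX mY])
  have mean: "AE \<omega> in law Z. real_cond_exp (law Z) Hist (\<lambda>\<omega>. trace (innov_cov Z (t0 + h) \<omega>)) \<omega>
      = (1 - K h \<omega>)\<^sup>2 * trace \<Sigma>"
    if mZ: "continuation_model dt t0 Hist Z" and rZ: "stabilized_regime t0 Hist lam \<Sigma> Z K \<zeta> \<nu>"
      and k0: "\<forall>\<omega>\<in>space Hist. K 0 \<omega> = k0" for Z K \<zeta> \<nu> k0 h
  proof -
    interpret Z: sigma_finite_subalgebra "law Z" Hist by (rule continuation_model_subalgebras(2)[OF mZ])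
    note [measurable] = stabilized_regimeD(2)[OF rZ]
    have [measurable]: "K h \<in> borel_measurable (law Z)"
      by (rule measurable_from_subalg[OF Z.subalg]) measurable
    have "AE \<omega> in law Z. trace (innov_cov Z (t0 + h) \<omega>) = (1 - K h \<omega>)\<^sup>2 * trace \<Sigma>"
      using stabilized_innov_cov[OF mZ rZ k0, of h]
      by eventually_elim (simp add: trace_def sum_distrib_left)
    then have "AE \<omega> in law Z. real_cond_exp (law Z) Hist (\<lambda>\<omega>. trace (innov_cov Z (t0 + h) \<omega>)) \<omega>
        = real_cond_exp (law Z) Hist (\<lambda>\<omega>. (1 - K h \<omega>)\<^sup>2 * trace \<Sigma>) \<omega>"
      by (rule Z.real_cond_exp_cong) (rule trace_innov_cov_measurable, measurable)
    moreover have "AE \<omega> in law Z. real_cond_exp (law Z) Hist (\<lambda>\<omega>. (1 - K h \<omega>)\<^sup>2 * trace \<Sigma>) \<omega>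
        = (1 - K h \<omega>)\<^sup>2 * trace \<Sigma>"
      by (rule Z.real_cond_exp_subalg_measurable(2)) measurable
    ultimately show ?thesis by eventually_elim simp
  qed
  note [measurable] = stabilized_regimeD(2)[OF rX] stabilized_regimeD(2)[OF rY]
  have "AE \<omega> in Hist. variance_response t0 Hist X Y h \<omega>
      = ((1 - KX h \<omega>)\<^sup>2 - (1 - KY h \<omega>)\<^sup>2) * trace \<Sigma>" for h
  proof -
    have "AE \<omega> in Hist. real_cond_exp (law X) Hist (\<lambda>\<omega>. trace (innov_cov X (t0 + h) \<omega>)) \<omega>
        = (1 - KX h \<omega>)\<^sup>2 * trace \<Sigma>"
      by (rule AE_history_cond_exp(1)[OF _ mean[OF mX rX onset(1)]]) measurable
    moreover have "AE \<omega> in Hist. real_cond_exp (law Y) Hist (\<lambda>\<omega>. trace (innov_cov Y (t0 + h) \<omega>)) \<omega>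
        = (1 - KY h \<omega>)\<^sup>2 * trace \<Sigma>"
      by (rule AE_history_cond_exp(2)[OF _ mean[OF mY rY onset(2)]]) measurable
    ultimately show ?thesis
      by eventually_elim (simp add: variance_response_def left_diff_distrib)
  qed
  then show ?thesis by (simp add: AE_all_countable)
qed

text \<open>
The map \<open>k \<mapsto> (1 - k)\<^sup>2\<close> is decreasing for \<open>k \<le> 1\<close>, which is where the bound on the gain keeps the
schedule.
\<close>

lemma gain_response_properties:
  fixes k :: "nat \<Rightarrow> real"
  assumes v: "\<And>h. v h = ((1 - k h)\<^sup>2 - 1) * T" and T: "0 < T" and Kmax: "Kmax < 1"
    and mono: "incseq k" and le: "\<And>h. k h \<le> Kmax"
  shows "v h = - k h * (2 - k h) * T" "k h = 0 \<Longrightarrow> v h = 0" "0 < k h \<Longrightarrow> v h < 0"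
    and "decseq v" "k \<longlonglongrightarrow> Kmax \<Longrightarrow> v \<longlonglongrightarrow> - Kmax * (2 - Kmax) * T"
proof -
  have v': "v h = - k h * (2 - k h) * T" for h
    by (simp add: v power2_eq_square algebra_simps)
  then show "v h = - k h * (2 - k h) * T" "k h = 0 \<Longrightarrow> v h = 0" by simp_all
  show "v h < 0" if "0 < k h"
  proof -
    have "0 < k h * (2 - k h) * T"
      using that le[of h] Kmax T by (intro mult_pos_pos) auto
    then show ?thesis by (simp add: v')
  qed
  show "decseq v"
  proof (rule decseq_SucI)
    fix n
    have "0 \<le> 1 - k (Suc n)" "1 - k (Suc n) \<le> 1 - k n"
      using le[of "Suc n"] Kmax incseq_SucD[OF mono, of n] by auto
    then have "(1 - k (Suc n))\<^sup>2 \<le> (1 - k n)\<^sup>2" by (rule power_mono[rotated])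
    then show "v (Suc n) \<le> v n" using T by (simp add: v)
  qed
  show "v \<longlonglongrightarrow> - Kmax * (2 - Kmax) * T" if "k \<longlonglongrightarrow> Kmax"
    unfolding v' by (intro tendsto_intros that)
qed

text \<open>
An inert covariance must dominate a positive definite \<open>C\<close>, so a deterministic model is not a witness;
a process with innovations of fixed covariance is needed.  The unperturbed continuation \<open>Y\<close> is one,
with \<open>C = \<Sigma>\<close> and \<open>G = 0\<close>.  The perturbed partner lives under the same law with the same innovations and
steering: adding a constant to the velocity of \<open>Y\<close> and the resulting drift to its displacement respects
the linear dynamics.
\<close>

lemma equivalent_inert_comparison_exists:
  fixes Y :: "'a continuation"
  assumes comp: "stabilized_comparison dt t0 Hist \<eta> lam \<Sigma> d X K \<zeta>X \<nu>X Y (\<lambda>_ _. 0) \<zeta>Y \<nu>Y"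
  shows "\<exists>(C :: real^3^3) (E :: 'w measure) G X' WX Y' WY.
    inert_comparison dt t0 Hist C E G (\<eta> *\<^sub>R d) X' WX Y' WY"
proof -
  have imp: "impulse_comparison dt t0 Hist (\<eta> *\<^sub>R d) X Y"
    and rY: "stabilized_regime t0 Hist lam \<Sigma> Y (\<lambda>_ _. 0) \<zeta>Y \<nu>Y"
    using comp unfolding stabilized_comparison_def by blast+
  note mY = impulse_comparisonD(2)[OF imp]
  define X' where "X' = Y\<lparr>disp := \<lambda>t \<omega>. disp Y t \<omega> + (real (t - t0) * dt) *\<^sub>R (\<eta> *\<^sub>R d),
    vel := \<lambda>t \<omega>. vel Y t \<omega> + \<eta> *\<^sub>R d\<rparr>"
  define E :: "'w measure" where "E = count_space UNIV"
  define W :: "nat \<Rightarrow> 'a \<Rightarrow> 'w" where "W = (\<lambda>_ _. undefined)"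
  define G :: "'w \<Rightarrow> real^3^3" where "G = (\<lambda>_. 0)"
  have same: "law X' = law Y" "info X' = info Y" "steer X' = steer Y" "innov X' = innov Y"
    "innov_cov X' = innov_cov Y"
    by (simp_all add: X'_def innov_cov_def fun_eq_iff)
  have "continuation_model dt t0 Hist X'"
    using mY unfolding continuation_model_def same
    by (auto simp: X'_def Suc_diff_le algebra_simps)
  then have imp': "impulse_comparison dt t0 Hist (\<eta> *\<^sub>R d) X' Y"
    unfolding impulse_comparison_def same
    using mY impulse_comparisonD(3,4)[OF imp] by (auto simp: X'_def)
  have cov: "AE \<omega> in law Y. innov_cov Y t \<omega> = \<Sigma>" if "t0 \<le> t" for t
    using stabilized_innov_cov[OF mY rY, of 0 "t - t0"] that by simp
  interpret H: sigma_finite_subalgebra "law Y" Hist by (rule continuation_model_subalgebras(2)[OF mY])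
  have "AE \<omega> in law Y. ennreal (trace \<Sigma>) = nn_cond_exp (law Y) Hist (\<lambda>_. ennreal (trace \<Sigma>)) \<omega>"
    by (rule H.nn_cond_exp_F_meas) simp
  then have "AE \<omega> in law Y. nn_cond_exp (law Y) Hist (\<lambda>_. ennreal (trace \<Sigma>)) \<omega> < \<infinity>"
    by eventually_elim (erule subst, simp)
  then have "AE \<omega> in restr_to_subalg (law Y) Hist. nn_cond_exp (law Y) Hist (\<lambda>_. ennreal (trace \<Sigma>)) \<omega> < \<infinity>"
    by (rule AE_restr_to_subalg2[OF H.subalg]) measurable
  then have fin: "AE \<omega> in Hist. nn_cond_exp (law Y) Hist (\<lambda>_. ennreal (trace \<Sigma>)) \<omega> < \<infinity>"
    by (simp only: continuation_model_subalgebras(4)[OF mY])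
  have regime: "inert_regime t0 Hist \<Sigma> E G Y W"
    unfolding inert_regime_def using stabilized_regimeD(1)[OF rY] cov fin
    by (auto simp: E_def G_def W_def pos_semidef_def transpose_def vec_eq_iff)
  then have "inert_regime t0 Hist \<Sigma> E G X' W"
    unfolding inert_regime_def same .
  moreover have "same_environment_law t0 Hist E X' W Y W"
    unfolding same_environment_law_def same by simp
  ultimately have "inert_comparison dt t0 Hist \<Sigma> E G (\<eta> *\<^sub>R d) X' W Y W"
    using imp' regime by (simp add: inert_comparison_def)
  then show ?thesis by blast
qed

theorem proposition4:
  fixes dt \<eta> lam Kmax :: real and t0 :: nat and \<delta> :: "real^3"
    and Hist :: "'a measure" and E :: "'w measure" and \<Sigma> C :: "real^3^3" and G :: "'w \<Rightarrow> real^3^3"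
    and XI YI XS YS XC YC :: "'a continuation" and WX WY :: "nat \<Rightarrow> 'a \<Rightarrow> 'w"
    and K :: "nat \<Rightarrow> 'a \<Rightarrow> real" and \<kappa> :: real
    and \<zeta>X \<nu>X \<zeta>Y \<nu>Y \<zeta>XC \<nu>XC \<zeta>YC \<nu>YC :: "nat \<Rightarrow> 'a \<Rightarrow> real^3"
  assumes "0 < dt" and "1 \<le> t0" and "\<delta> \<noteq> 0"
    and "0 < \<eta>" and "\<eta> \<le> 1" and "0 \<le> lam" and "lam \<le> 1"
  shows
    "(inert_comparison dt t0 Hist C E G \<delta> XI WX YI WY \<longrightarrow>
        (AE \<omega> in Hist. \<forall>h.
            level_response t0 Hist \<delta> XI YI h \<omega> = norm \<delta> * real h * dt
          \<and> variance_response t0 Hist XI YI h \<omega> = 0))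
     \<and>
     (stabilized_comparison dt t0 Hist \<eta> lam \<Sigma> \<delta> XS K \<zeta>X \<nu>X YS (\<lambda>_ _. 0) \<zeta>Y \<nu>Y
        \<and> gain_episode Hist Kmax K \<longrightarrow>
        (AE \<omega> in Hist. \<forall>h. level_response t0 Hist \<delta> XS YS h \<omega> = \<eta> * norm \<delta> * real h * dt)
      \<and> (\<forall>(C' :: real^3^3) (E' :: 'w measure) G' X' WX' Y' WY'.
           inert_comparison dt t0 Hist C' E' G' (\<eta> *\<^sub>R \<delta>) X' WX' Y' WY' \<longrightarrow>
           (AE \<omega> in Hist. \<forall>h.
              level_response t0 Hist \<delta> XS YS h \<omega> = level_response t0 Hist (\<eta> *\<^sub>R \<delta>) X' Y' h \<omega>))
      \<and> (\<exists>(C' :: real^3^3) (E' :: 'w measure) G' X' WX' Y' WY'.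
           inert_comparison dt t0 Hist C' E' G' (\<eta> *\<^sub>R \<delta>) X' WX' Y' WY' \<and>
           (AE \<omega> in Hist. \<forall>h.
              level_response t0 Hist \<delta> XS YS h \<omega> = level_response t0 Hist (\<eta> *\<^sub>R \<delta>) X' Y' h \<omega>))
      \<and> (AE \<omega> in Hist.
           (\<forall>h. variance_response t0 Hist XS YS h \<omega> = ((1 - K h \<omega>)\<^sup>2 - 1) * trace \<Sigma>
              \<and> variance_response t0 Hist XS YS h \<omega> = - K h \<omega> * (2 - K h \<omega>) * trace \<Sigma>
              \<and> (K h \<omega> = 0 \<longrightarrow> variance_response t0 Hist XS YS h \<omega> = 0)
              \<and> (0 < K h \<omega> \<longrightarrow> variance_response t0 Hist XS YS h \<omega> < 0))
         \<and> decseq (\<lambda>h. variance_response t0 Hist XS YS h \<omega>)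
         \<and> ((\<lambda>h. K h \<omega>) \<longlonglongrightarrow> Kmax \<longrightarrow>
              (\<lambda>h. variance_response t0 Hist XS YS h \<omega>) \<longlonglongrightarrow> - Kmax * (2 - Kmax) * trace \<Sigma>))
      \<and> - Kmax * (2 - Kmax) * trace \<Sigma> < 0)
     \<and>
     (stabilized_comparison dt t0 Hist \<eta> lam \<Sigma> \<delta>
          XC (\<lambda>_ _. \<kappa>) \<zeta>XC \<nu>XC YC (\<lambda>_ _. \<kappa>) \<zeta>YC \<nu>YC \<longrightarrow>
        (AE \<omega> in Hist. \<forall>h. variance_response t0 Hist XC YC h \<omega> = 0))"
proof -
  have inert_level: "AE \<omega> in Hist. \<forall>h. level_response t0 Hist d X Y h \<omega> = norm d * real h * dt"
    if "inert_comparison dt t0 Hist C' E' G' d X W Y W'"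
    for C' and E' :: "'w measure" and G' d and X Y :: "'a continuation" and W W'
    using that level_response_along_impulse[of dt t0 Hist 1 d X Y] by (simp add: inert_comparison_def)
  have inert: "AE \<omega> in Hist. \<forall>h. level_response t0 Hist \<delta> XI YI h \<omega> = norm \<delta> * real h * dt
          \<and> variance_response t0 Hist XI YI h \<omega> = 0"
    if "inert_comparison dt t0 Hist C E G \<delta> XI WX YI WY"
    using inert_level[OF that] inert_variance_response[OF that] by eventually_elim simp
  have constant_gain: "AE \<omega> in Hist. \<forall>h. variance_response t0 Hist XC YC h \<omega> = 0"
    if "stabilized_comparison dt t0 Hist \<eta> lam \<Sigma> \<delta>
          XC (\<lambda>_ _. \<kappa>) \<zeta>XC \<nu>XC YC (\<lambda>_ _. \<kappa>) \<zeta>YC \<nu>YC"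
    using stabilized_variance_response[OF that, of \<kappa> \<kappa>] by simp
  {
    assume comp: "stabilized_comparison dt t0 Hist \<eta> lam \<Sigma> \<delta> XS K \<zeta>X \<nu>X YS (\<lambda>_ _. 0) \<zeta>Y \<nu>Y"
      and "gain_episode Hist Kmax K"
    then have Kmax: "0 < Kmax" "Kmax < 1"
      and K: "\<omega> \<in> space Hist \<Longrightarrow> K 0 \<omega> = 0" "\<omega> \<in> space Hist \<Longrightarrow> incseq (\<lambda>h. K h \<omega>)"
        "\<omega> \<in> space Hist \<Longrightarrow> K h \<omega> \<le> Kmax" for \<omega> h
      by (auto simp: gain_episode_def)
    have imp: "impulse_comparison dt t0 Hist (\<eta> *\<^sub>R \<delta>) XS YS" and "pos_def \<Sigma>"
      using comp by (auto simp: stabilized_comparison_def stabilized_regime_def)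
    then have T: "0 < trace \<Sigma>" by (intro pos_def_trace_pos)
    note level = level_response_along_impulse[OF imp]
    have same_level: "AE \<omega> in Hist. \<forall>h.
        level_response t0 Hist \<delta> XS YS h \<omega> = level_response t0 Hist (\<eta> *\<^sub>R \<delta>) X' Y' h \<omega>"
      if "inert_comparison dt t0 Hist C' E' G' (\<eta> *\<^sub>R \<delta>) X' W Y' W'"
      for C' and E' :: "'w measure" and G' X' Y' W W'
      using level inert_level[OF that] by eventually_elim (use \<open>0 < \<eta>\<close> in simp)
    have var: "AE \<omega> in Hist.
        (\<forall>h. variance_response t0 Hist XS YS h \<omega> = ((1 - K h \<omega>)\<^sup>2 - 1) * trace \<Sigma>
              \<and> variance_response t0 Hist XS YS h \<omega> = - K h \<omega> * (2 - K h \<omega>) * trace \<Sigma>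
              \<and> (K h \<omega> = 0 \<longrightarrow> variance_response t0 Hist XS YS h \<omega> = 0)
              \<and> (0 < K h \<omega> \<longrightarrow> variance_response t0 Hist XS YS h \<omega> < 0))
         \<and> decseq (\<lambda>h. variance_response t0 Hist XS YS h \<omega>)
         \<and> ((\<lambda>h. K h \<omega>) \<longlonglongrightarrow> Kmax \<longrightarrow>
              (\<lambda>h. variance_response t0 Hist XS YS h \<omega>) \<longlonglongrightarrow> - Kmax * (2 - Kmax) * trace \<Sigma>)"
      using stabilized_variance_response[OF comp ballI[OF K(1)], of 0, simplified] AE_space
    proof eventually_elim
      case (elim \<omega>)
      then have v: "variance_response t0 Hist XS YS h \<omega> = ((1 - K h \<omega>)\<^sup>2 - 1) * trace \<Sigma>" for h
        by simp
      note props = gain_response_properties[of "\<lambda>h. variance_response t0 Hist XS YS h \<omega>" "\<lambda>h. K h \<omega>",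
          OF v T Kmax(2) K(2,3)[OF elim(2)]]
      show ?case using v props by blast
    qed
    have "0 < Kmax * (2 - Kmax) * trace \<Sigma>" using Kmax T by (intro mult_pos_pos) auto
    then have neg: "- Kmax * (2 - Kmax) * trace \<Sigma> < 0" by simp
    obtain C' and E' :: "'w measure" and G' X' W Y' W'
      where "inert_comparison dt t0 Hist C' E' G' (\<eta> *\<^sub>R \<delta>) X' W Y' W'"
      using equivalent_inert_comparison_exists[OF comp] by blast
    with same_level[OF this] have ex: "\<exists>(C' :: real^3^3) (E' :: 'w measure) G' X' WX' Y' WY'.
           inert_comparison dt t0 Hist C' E' G' (\<eta> *\<^sub>R \<delta>) X' WX' Y' WY' \<and>
           (AE \<omega> in Hist. \<forall>h.
              level_response t0 Hist \<delta> XS YS h \<omega> = level_response t0 Hist (\<eta> *\<^sub>R \<delta>) X' Y' h \<omega>)"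
      by blast
    note level same_level ex var neg
  }
  then show ?thesis using inert constant_gain by (intro conjI impI allI) auto
qed

end
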